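(* Let $L$ be the $n\times n$ Laplacian of a connected weighted undirected multigraph, with $m$ non-zero entries. Suppose $Z = P\,\mathcal{L}\,\mathcal{D}\,\mathcal{L}^{\top}P^{\top}$, where $P$ is a permutation matrix, $\mathcal{L}$ is a lower triangular matrix with $O(m\log^{3} n)$ non-zero entries and $\mathcal{D}$ is a diagonal matrix, satisfies $\tfrac12 L \preceq Z \preceq \tfrac32 L$ (such a factorization is what the algorithm SparseCholesky outputs with probability $1-1/\mathrm{poly}(n)$). For a vector $b$ with $\mathbf{1}^{\top}b=0$, define the iteration $x^{(0)}=0$, $x^{(i+1)} = x^{(i)} - \tfrac12 Z^{+}(Lx^{(i)}-b)$. Then for every $\epsilon>0$, with $t = 3\log(1/\epsilon)$, we have $\|x^{(t)} - L^{+}b\|_{L} \le \epsilon\,\|L^{+}b\|_{L}$, and (given the factors $P,\mathcal{L},\mathcal{D}$) such an $x^{(t)}$ can be computed in time $O(m\log^{3} n\,\log(1/\epsilon))$.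
   Context: For symmetric matrices $A,B$, $A\preceq B$ means $B-A$ is positive semidefinite. $L^{+}$, $Z^{+}$ denote Moore–Penrose pseudo-inverses. $\mathbf{1}$ is the all-ones vector, and for a vector $v$, $\|v\|_{L} = \sqrt{v^{\top}Lv}$. A Laplacian of a weighted multigraph with vertex set $\{1,\dots,n\}$ is $\sum_{e} w(e)(\mathbf{e}_v-\mathbf{e}_u)(\mathbf{e}_v-\mathbf{e}_u)^{\top}$, summing over multi-edges $e$ with endpoints $u,v$ and positive weights $w(e)$; for a connected multigraph its kernel is the span of $\mathbf{1}$. *)

theory Defs
  imports
    Complex_Main
    "HOL-Library.Multiset"
    "HOL-Combinatorics.Permutations"
    "Jordan_Normal_Form.Matrix"
begin

section \<open>Laplacians, the Loewner order and pseudo-inverses\<close>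

text \<open>
  A weighted undirected multigraph on the vertices \<open>0, \<dots>, n - 1\<close> is a multiset of
  triples \<open>(u, v, w)\<close>, one for each multi-edge, with endpoints \<open>u \<noteq> v\<close> in either order and
  weight \<open>w > 0\<close>.
\<close>

type_synonym multigraph = "(nat \<times> nat \<times> real) multiset"

definition weighted_multigraph :: "nat \<Rightarrow> multigraph \<Rightarrow> bool" where
  "weighted_multigraph n E \<longleftrightarrow>
     0 < n \<and> (\<forall>(u, v, w)\<in>#E. u < n \<and> v < n \<and> u \<noteq> v \<and> 0 < w)"

definition adjacency :: "multigraph \<Rightarrow> (nat \<times> nat) set" where
  "adjacency E = {(u, v). \<exists>w. (u, v, w) \<in># E \<or> (v, u, w) \<in># E}"

definition connected_multigraph :: "nat \<Rightarrow> multigraph \<Rightarrow> bool" where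
  "connected_multigraph n E \<longleftrightarrow>
     weighted_multigraph n E \<and> (\<forall>u<n. \<forall>v<n. (u, v) \<in> (adjacency E)\<^sup>*)"

text \<open>
  Entry \<open>(i, j)\<close> of the sum of the rank-one matrices
  \<open>w (e\<^sub>v - e\<^sub>u) (e\<^sub>v - e\<^sub>u)\<^sup>T\<close> over all multi-edges.
\<close>

definition laplacian :: "nat \<Rightarrow> multigraph \<Rightarrow> real mat" where
  "laplacian n E = mat n n (\<lambda>(i, j).
     \<Sum>(u, v, w)\<in>#E. w * ((unit_vec n v - unit_vec n u) $ i * (unit_vec n v - unit_vec n u) $ j))"

definition nnz :: "real mat \<Rightarrow> nat" where
  "nnz A = card {(i, j). i < dim_row A \<and> j < dim_col A \<and> A $$ (i, j) \<noteq> 0}"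

definition permutation_mat :: "nat \<Rightarrow> real mat \<Rightarrow> bool" where
  "permutation_mat n P \<longleftrightarrow>
     (\<exists>p. p permutes {..<n} \<and> P = mat n n (\<lambda>(i, j). if j = p i then 1 else 0))"

definition lower_triangular :: "real mat \<Rightarrow> bool" where
  "lower_triangular A \<longleftrightarrow> (\<forall>j<dim_col A. \<forall>i<j. A $$ (i, j) = 0)"

definition psd :: "real mat \<Rightarrow> bool" where
  "psd A \<longleftrightarrow> A\<^sup>T = A \<and> (\<forall>v\<in>carrier_vec (dim_row A). 0 \<le> v \<bullet> (A *\<^sub>v v))"

definition loewner_le :: "real mat \<Rightarrow> real mat \<Rightarrow> bool" where
  "loewner_le A B \<longleftrightarrow> psd (B - A)"

text \<open>The Moore-Penrose pseudo-inverse of a real matrix, by the four Penrose conditions.\<close>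

definition is_pinv :: "real mat \<Rightarrow> real mat \<Rightarrow> bool" where
  "is_pinv A X \<longleftrightarrow>
     X \<in> carrier_mat (dim_col A) (dim_row A) \<and>
     A * X * A = A \<and> X * A * X = X \<and> (A * X)\<^sup>T = A * X \<and> (X * A)\<^sup>T = X * A"

definition pinv :: "real mat \<Rightarrow> real mat" where
  "pinv A = (THE X. is_pinv A X)"

definition lap_norm :: "real mat \<Rightarrow> real vec \<Rightarrow> real" where
  "lap_norm L v = sqrt (v \<bullet> (L *\<^sub>v v))"

definition all_ones :: "nat \<Rightarrow> real vec" where
  "all_ones n = vec n (\<lambda>_. 1)"

definition factored :: "real mat \<Rightarrow> real mat \<Rightarrow> real mat \<Rightarrow> real mat" where
  "factored P M D = P * M * D * M\<^sup>T * P\<^sup>T"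

definition approx_factorization :: "nat \<Rightarrow> real mat \<Rightarrow> real mat \<Rightarrow> real mat \<Rightarrow> real mat \<Rightarrow> bool" where
  "approx_factorization n L P M D \<longleftrightarrow>
     permutation_mat n P \<and>
     M \<in> carrier_mat n n \<and> lower_triangular M \<and>
     D \<in> carrier_mat n n \<and> diagonal_mat D \<and>
     loewner_le ((1/2) \<cdot>\<^sub>m L) (factored P M D) \<and>
     loewner_le (factored P M D) ((3/2) \<cdot>\<^sub>m L)"

fun iterate :: "real mat \<Rightarrow> real mat \<Rightarrow> real vec \<Rightarrow> nat \<Rightarrow> real vec" where
  "iterate L Z b 0 = 0\<^sub>v (dim_row L)"
| "iterate L Z b (Suc i) =
     iterate L Z b i - (1/2) \<cdot>\<^sub>v (pinv Z *\<^sub>v (L *\<^sub>v iterate L Z b i - b))"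

text \<open>
  The least natural number that is at least \<open>3 log (1/\<epsilon>)\<close>; it is \<open>0\<close> for \<open>\<epsilon> \<ge> 1\<close>.
\<close>

definition num_iterations :: "real \<Rightarrow> nat" where
  "num_iterations \<epsilon> = nat \<lceil>3 * ln (1 / \<epsilon>)\<rceil>"

section \<open>A real random access machine\<close>

text \<open>
  Running times are step counts of programs of a while language over a real RAM: a store has
  named arrays of natural numbers (used for indices) and named arrays of real numbers; a scalar
  variable is cell \<open>0\<close> of an array. Exact real arithmetic, \<open>ln\<close>, comparisons and
  indexed memory accesses are primitive. There is no conversion from reals to natural numbers.
  Division and \<open>ln\<close> are the totalised HOL functions.

  Each elementary command and each evaluation of a test costs one step. A program is a single
  finite object that does not depend on the input, so the expressions occurring in it have
  constant size and charging for every operation inside them would change the step count only by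
  a constant factor.
\<close>

type_synonym name = string

record state =
  nats :: "name \<Rightarrow> nat \<Rightarrow> nat"
  reals :: "name \<Rightarrow> nat \<Rightarrow> real"

datatype nexp =
    NConst nat
  | NGet name nexp
  | NAdd nexp nexp
  | NSub nexp nexp

datatype rexp =
    RConst int
  | RGet name nexp
  | RAdd rexp rexp
  | RSub rexp rexp
  | RMul rexp rexp
  | RDiv rexp rexp
  | RLn rexp

datatype bexp =
    NLess nexp nexp
  | RLess rexp rexp
  | Neg bexp
  | Conj bexp bexp

datatype com =
    Skip
  | NPut name nexp nexp
  | RPut name nexp rexp
  | Seq com com
  | Cond bexp com com
  | Loop bexp com

fun nval :: "nexp \<Rightarrow> state \<Rightarrow> nat" where
  "nval (NConst k) s = k"
| "nval (NGet a e) s = nats s a (nval e s)"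
| "nval (NAdd e f) s = nval e s + nval f s"
| "nval (NSub e f) s = nval e s - nval f s"

fun rval :: "rexp \<Rightarrow> state \<Rightarrow> real" where
  "rval (RConst k) s = of_int k"
| "rval (RGet a e) s = reals s a (nval e s)"
| "rval (RAdd e f) s = rval e s + rval f s"
| "rval (RSub e f) s = rval e s - rval f s"
| "rval (RMul e f) s = rval e s * rval f s"
| "rval (RDiv e f) s = rval e s / rval f s"
| "rval (RLn e) s = ln (rval e s)"

fun bval :: "bexp \<Rightarrow> state \<Rightarrow> bool" where
  "bval (NLess e f) s \<longleftrightarrow> nval e s < nval f s"
| "bval (RLess e f) s \<longleftrightarrow> rval e s < rval f s"
| "bval (Neg b) s \<longleftrightarrow> \<not> bval b s"
| "bval (Conj b c) s \<longleftrightarrow> bval b s \<and> bval c s"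

definition put :: "(name \<Rightarrow> nat \<Rightarrow> 'a) \<Rightarrow> name \<Rightarrow> nat \<Rightarrow> 'a \<Rightarrow> name \<Rightarrow> nat \<Rightarrow> 'a" where
  "put m a i x = m(a := (m a)(i := x))"

text \<open>\<open>exec c s T s'\<close>: started in \<open>s\<close>, \<open>c\<close> halts in \<open>s'\<close> after exactly \<open>T\<close> steps.\<close>

inductive exec :: "com \<Rightarrow> state \<Rightarrow> nat \<Rightarrow> state \<Rightarrow> bool" where
  Skip: "exec Skip s 1 s"
| NPut: "exec (NPut a i e) s 1 (s\<lparr>nats := put (nats s) a (nval i s) (nval e s)\<rparr>)"
| RPut: "exec (RPut a i e) s 1 (s\<lparr>reals := put (reals s) a (nval i s) (rval e s)\<rparr>)"
| Seq: "exec c s T s' \<Longrightarrow> exec d s' T' s'' \<Longrightarrow> exec (Seq c d) s (T + T') s''"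
| CondTrue: "bval b s \<Longrightarrow> exec c s T s' \<Longrightarrow> exec (Cond b c d) s (1 + T) s'"
| CondFalse: "\<not> bval b s \<Longrightarrow> exec d s T s' \<Longrightarrow> exec (Cond b c d) s (1 + T) s'"
| LoopFalse: "\<not> bval b s \<Longrightarrow> exec (Loop b c) s 1 s"
| LoopTrue: "bval b s \<Longrightarrow> exec c s T s' \<Longrightarrow> exec (Loop b c) s' T' s'' \<Longrightarrow>
    exec (Loop b c) s (1 + T + T') s''"

lemma exec_deterministic:
  assumes "exec c s T s'" "exec c s U s''"
  shows "T = U \<and> s' = s''"
  using assms
proof (induction arbitrary: U s'' rule: exec.induct)
  case (Skip s)
  then show ?case by (auto elim: exec.cases)
next
  case (NPut a i e s)
  then show ?case by (auto elim: exec.cases)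
next
  case (RPut a i e s)
  then show ?case by (auto elim: exec.cases)
next
  case (Seq c s T s1 d T' s2)
  from Seq.prems show ?case by cases (use Seq.IH in blast)
next
  case (CondTrue b s c T s' d)
  from CondTrue.prems show ?case by cases (use CondTrue in blast)+
next
  case (CondFalse b s d T s' c)
  from CondFalse.prems show ?case by cases (use CondFalse in blast)+
next
  case (LoopFalse b s c)
  from LoopFalse.prems show ?case by cases (use LoopFalse in blast)+
next
  case (LoopTrue b s c T s1 T' s2)
  from LoopTrue.prems show ?case by cases (use LoopTrue in blast)+
qed

section \<open>Input and output\<close>

text \<open>
  Compressed sparse row storage: the non-zero entries of row \<open>i\<close> occupy the positions from
  \<open>ptr i\<close> up to but excluding \<open>ptr (i + 1)\<close>, each exactly once and in any order;
  \<open>cidx\<close> and \<open>entry\<close> hold their column indices and values.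
\<close>

definition csr :: "real mat \<Rightarrow> (nat \<Rightarrow> nat) \<Rightarrow> (nat \<Rightarrow> nat) \<Rightarrow> (nat \<Rightarrow> real) \<Rightarrow> bool" where
  "csr A ptr cidx entry \<longleftrightarrow> ptr 0 = 0 \<and>
     (\<forall>i<dim_row A.
        ptr i \<le> ptr (Suc i) \<and>
        bij_betw cidx {ptr i..<ptr (Suc i)} {j. j < dim_col A \<and> A $$ (i, j) \<noteq> 0} \<and>
        (\<forall>k\<in>{ptr i..<ptr (Suc i)}. entry k = A $$ (i, cidx k)))"

text \<open>
  All cells not mentioned here may hold arbitrary values; in particular neither the number of
  iterations nor any product or (pseudo-)inverse of the factors is supplied.
\<close>

definition input_state ::
  "nat \<Rightarrow> real mat \<Rightarrow> real mat \<Rightarrow> real mat \<Rightarrow> real mat \<Rightarrow> real vec \<Rightarrow> real \<Rightarrow> state \<Rightarrow> bool" where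
  "input_state n L P M D b \<epsilon> s \<longleftrightarrow>
     nats s ''n'' 0 = n \<and>
     reals s ''eps'' 0 = \<epsilon> \<and>
     (\<forall>i<n. reals s ''b'' i = b $ i) \<and>
     csr L (nats s ''L_ptr'') (nats s ''L_col'') (reals s ''L_val'') \<and>
     (\<forall>i<n. nats s ''P'' i < n \<and> P $$ (i, nats s ''P'' i) = 1) \<and>
     csr M (nats s ''M_ptr'') (nats s ''M_col'') (reals s ''M_val'') \<and>
     (\<forall>i<n. reals s ''D'' i = D $$ (i, i))"

definition outputs :: "state \<Rightarrow> real vec \<Rightarrow> bool" where
  "outputs s x \<longleftrightarrow> (\<forall>i<dim_vec x. reals s ''x'' i = x $ i)"

end

(*
Write <x, y>_L = x^T L y and W = Z^+ L. The Loewner bounds force Z to have the kernel of L, the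
span of the all-ones vector, and they make W self-adjoint for <., .>_L with spectrum in [2/3, 2].
Hence I - W/2 contracts the L-norm by 2/3 < exp(-1/3), and 3 log(1/eps) steps suffice.

One step costs a product with L and an application of Z^+. The first n - 1 pivots of the
factorization are non-zero: a vanishing one would yield a non-constant kernel vector of Z. So the
first n - 1 equations of Z v = r can be solved by forward and backward substitution with last
unknown 0; as r is orthogonal to the all-ones vector the last equation then holds too, and
subtracting its mean from v gives Z^+ r. All loops run over the stored non-zero entries.
*)
theory Submission
  imports Defs "Jordan_Normal_Form.Determinant"
begin

section \<open>Pseudo-inverses of symmetric matrices with constant kernel\<close>

text \<open>No spectral theorem is invoked. Every statement on the spectrum of \<open>W\<close> is
  read as a statement on the forms of \<open>e\<close>, \<open>W e\<close> and
  \<open>W (W e)\<close>, derived from the two Loewner bounds by completing squares; the contraction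
  is a linear combination of three such inequalities. The machine shapes the solver. The triangular
  factor is stored by rows only, so the solve with its transpose is column-oriented: each computed
  unknown is subtracted from the remaining right-hand sides along its row. Entries of a row come in
  any order, so the diagonal is extracted beforehand. Indices cannot be converted to reals or back:
  \<open>n\<close> as a real is obtained by counting, and the iteration counter is a real that is
  compared with \<open>3 ln (1 / eps)\<close>. Work proportional to \<open>n\<close> is charged to
  the non-zero entries of \<open>L\<close>, whose diagonal is full once
  \<open>n >= 2\<close>.\<close>

lemma is_pinv_unique:
  assumes X: "is_pinv A X" and Y: "is_pinv A Y"
  shows "X = Y"
proof -
  obtain n k where A: "A \<in> carrier_mat n k"
    by blast
  have C: "X \<in> carrier_mat k n" "Y \<in> carrier_mat k n"
    using X Y A by (auto simp: is_pinv_def)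
  note x = X[unfolded is_pinv_def] and y = Y[unfolded is_pinv_def]
  \<comment> \<open>Penrose's argument: \<open>A X = (A Y) (A X)\<close> is a product of symmetric
    matrices with symmetric result, so transposing reverses the factors and
    \<open>A X = A X A Y = A Y\<close>. The same on the other side gives \<open>X A = Y A\<close>,
    and then \<open>X = X A X = Y A Y = Y\<close>.\<close>
  have "A * X = (A * Y * A) * X"
    using y by simp
  also have "\<dots> = (A * Y) * (A * X)"
    using A C by (intro assoc_mult_mat) auto
  finally have "(A * X)\<^sup>T = (A * X)\<^sup>T * (A * Y)\<^sup>T"
    using A C transpose_mult[of "A * Y" n n "A * X" n] by auto
  then have "A * X = (A * X) * (A * Y)"
    using x y by simp
  also have "\<dots> = (A * X * A) * Y"
    using A C by (intro assoc_mult_mat[symmetric]) auto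
  finally have AX: "A * X = A * Y"
    using x by simp
  have "X * A = X * (A * Y * A)"
    using y by simp
  also have "\<dots> = X * (A * (Y * A))"
    using A C by (subst assoc_mult_mat[of A n k Y n A k]) auto
  also have "\<dots> = (X * A) * (Y * A)"
    using A C by (intro assoc_mult_mat[symmetric]) auto
  finally have "(X * A)\<^sup>T = (Y * A)\<^sup>T * (X * A)\<^sup>T"
    using A C transpose_mult[of "X * A" k k "Y * A" k] by auto
  then have "X * A = (Y * A) * (X * A)"
    using x y by simp
  also have "\<dots> = Y * (A * (X * A))"
    using A C by (intro assoc_mult_mat) auto
  also have "\<dots> = Y * (A * X * A)"
    using A C by (subst assoc_mult_mat[of A n k X n A k]) auto
  finally have XA: "X * A = Y * A"
    using x by simp
  have "X = Y * A * X"
    using x XA by simp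
  also have "\<dots> = Y * (A * Y)"
    using A C AX by (subst assoc_mult_mat) auto
  also have "\<dots> = Y"
    using A C y by (subst assoc_mult_mat[symmetric]) auto
  finally show ?thesis .
qed

lemma pinv_eqI: "is_pinv A X \<Longrightarrow> pinv A = X"
  unfolding pinv_def by (blast intro: is_pinv_unique the_equality)

text \<open>The property that \<open>L\<close> and \<open>Z\<close> share. The facts on
  pseudo-inverses are derived from it once and applied to both matrices.\<close>

definition kernel_is_constants :: "nat \<Rightarrow> real mat \<Rightarrow> bool" where
  "kernel_is_constants n A \<longleftrightarrow> 0 < n \<and> A \<in> carrier_mat n n \<and> A\<^sup>T = A \<and>
     (\<forall>x\<in>carrier_vec n. A *\<^sub>v x = 0\<^sub>v n \<longleftrightarrow> (\<exists>c. x = c \<cdot>\<^sub>v all_ones n))"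

lemma all_ones_carrier [simp]: "all_ones n \<in> carrier_vec n"
  by (simp add: all_ones_def)

lemma all_ones_scalar_prod: "x \<in> carrier_vec n \<Longrightarrow> all_ones n \<bullet> x = (\<Sum>i<n. x $ i)"
  by (simp add: all_ones_def scalar_prod_def lessThan_atLeast0)

section \<open>Quadratic forms of symmetric matrices\<close>

lemma symmetric_form_commute:
  fixes A :: "real mat"
  assumes "A \<in> carrier_mat n n" "A\<^sup>T = A" "x \<in> carrier_vec n" "y \<in> carrier_vec n"
  shows "x \<bullet> (A *\<^sub>v y) = y \<bullet> (A *\<^sub>v x)"
  using assms transpose_vec_mult_scalar[of A n n y x]
  by (metis comm_scalar_prod mult_mat_vec_carrier)

lemma real_scalar_prod_self_eq_0:
  fixes x :: "real vec"
  assumes "x \<in> carrier_vec n"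
  shows "x \<bullet> x = 0 \<longleftrightarrow> x = 0\<^sub>v n"
proof
  assume "x \<bullet> x = 0"
  then have "\<forall>i\<in>{0..<n}. x $ i * x $ i = 0"
    using assms by (subst (asm) scalar_prod_def, subst (asm) sum_nonneg_eq_0_iff) auto
  then show "x = 0\<^sub>v n"
    using assms by (intro eq_vecI) auto
qed (use assms in simp)

lemma real_scalar_prod_self_nonneg: "0 \<le> x \<bullet> (x :: real vec)"
  by (auto simp: scalar_prod_def intro: sum_nonneg)

text \<open>Bilinearity in one fixed shape. Vectors such as \<open>f - W f / 2\<close> or
  \<open>0 - p\<close> are written below with explicit coefficients so that their forms expand by
  these equations.\<close>

lemma form_add_smult:
  fixes A :: "real mat"
  assumes A: "A \<in> carrier_mat n n" and [simp]: "x \<in> carrier_vec n" "y \<in> carrier_vec n"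
    "z \<in> carrier_vec n"
  shows "z \<bullet> (A *\<^sub>v (a \<cdot>\<^sub>v x + c \<cdot>\<^sub>v y)) = a * (z \<bullet> (A *\<^sub>v x)) + c * (z \<bullet> (A *\<^sub>v y))"
    and "(a \<cdot>\<^sub>v x + c \<cdot>\<^sub>v y) \<bullet> (A *\<^sub>v z) = a * (x \<bullet> (A *\<^sub>v z)) + c * (y \<bullet> (A *\<^sub>v z))"
proof -
  have [simp]: "A *\<^sub>v v \<in> carrier_vec n" if "v \<in> carrier_vec n" for v
    using A that by simp
  have "A *\<^sub>v (a \<cdot>\<^sub>v x + c \<cdot>\<^sub>v y) = a \<cdot>\<^sub>v (A *\<^sub>v x) + c \<cdot>\<^sub>v (A *\<^sub>v y)"
    using A by (simp add: mult_add_distrib_mat_vec[of A n n] mult_mat_vec[of A n n])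
  then show "z \<bullet> (A *\<^sub>v (a \<cdot>\<^sub>v x + c \<cdot>\<^sub>v y)) = a * (z \<bullet> (A *\<^sub>v x)) + c * (z \<bullet> (A *\<^sub>v y))"
    using A by (simp add: scalar_prod_add_distrib[of _ n])
  show "(a \<cdot>\<^sub>v x + c \<cdot>\<^sub>v y) \<bullet> (A *\<^sub>v z) = a * (x \<bullet> (A *\<^sub>v z)) + c * (y \<bullet> (A *\<^sub>v z))"
    using A by (subst add_scalar_prod_distrib[of _ n]) (simp_all add: smult_scalar_prod_distrib[of _ n])
qed

text \<open>A zero of a non-negative form is a minimum, so the gradient direction \<open>A x\<close>
  vanishes there: otherwise a short move against it would make the form negative.\<close>

lemma psd_form_eq_0:
  assumes A: "A \<in> carrier_mat n n" and psd: "psd A" and x: "x \<in> carrier_vec n"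
    and z: "x \<bullet> (A *\<^sub>v x) = 0"
  shows "A *\<^sub>v x = 0\<^sub>v n"
proof (rule ccontr)
  define g where "g = A *\<^sub>v x"
  have g: "g \<in> carrier_vec n"
    using A x by (simp add: g_def)
  define p q where "p = g \<bullet> g" and "q = g \<bullet> (A *\<^sub>v g)"
  assume "A *\<^sub>v x \<noteq> 0\<^sub>v n"
  then have p: "p > 0"
    using g real_scalar_prod_self_eq_0[OF g] real_scalar_prod_self_nonneg[of g]
    by (auto simp: p_def g_def)
  have sym: "A\<^sup>T = A" and nn: "\<And>v. v \<in> carrier_vec n \<Longrightarrow> 0 \<le> v \<bullet> (A *\<^sub>v v)"
    using psd A by (auto simp: psd_def)
  have q: "q \<ge> 0"
    using nn g by (simp add: q_def)
  \<comment> \<open>The step length along \<open>g\<close>, for which the form becomes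
    \<open>s * (2 * p + s * q)\<close>. The denominator is \<open>1 + q\<close> because
    \<open>q\<close> may be 0; the second factor stays positive while \<open>s\<close> is
    negative.\<close>
  define s where "s = - p / (1 + q)"
  have xg: "x \<bullet> (A *\<^sub>v g) = p"
    using symmetric_form_commute[OF A sym x g] by (simp add: g_def p_def)
  have gx: "g \<bullet> (A *\<^sub>v x) = p"
    by (simp add: g_def p_def)
  let ?v = "1 \<cdot>\<^sub>v x + s \<cdot>\<^sub>v g"
  have v: "?v \<in> carrier_vec n"
    using x g by simp
  have "?v \<bullet> (A *\<^sub>v ?v) = 2 * s * p + s * s * q"
    using form_add_smult(1)[OF A x g v] form_add_smult(2)[OF A x g x]
      form_add_smult(2)[OF A x g g]
    by (simp only: z xg gx q_def[symmetric]) (simp add: algebra_simps)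
  then have "0 \<le> s * (2 * p + s * q)"
    using nn[OF v] by (simp add: algebra_simps)
  moreover have "s < 0"
    using p q by (simp add: s_def)
  moreover have "2 * p + s * q > 0"
  proof -
    have "2 * p + s * q = p * ((2 + q) / (1 + q))"
      using q by (simp add: s_def divide_simps) (simp add: algebra_simps)
    also have "\<dots> > 0"
      using p q by (intro mult_pos_pos divide_pos_pos) auto
    finally show ?thesis .
  qed
  ultimately show False
    by (simp add: mult_less_0_iff zero_le_mult_iff)
qed

text \<open>\<open>J\<close> is the orthogonal projection onto the constants. \<open>A\<close> kills
  its range and is injective on the complement, so \<open>A + J\<close> is invertible; removing
  \<open>J\<close> from the inverse leaves the inverse of \<open>A\<close> on the complement,
  extended by 0. Both \<open>A * X\<close> and \<open>X * A\<close> are then the symmetric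
  projection \<open>1 - J\<close>, which yields the Penrose conditions.\<close>

lemma ex_is_pinv_kernel_is_constants:
  assumes "kernel_is_constants n A"
  defines "J \<equiv> mat n n (\<lambda>_. 1 / real n)"
  obtains X where "is_pinv A X" "X \<in> carrier_mat n n" "A * X = 1\<^sub>m n - J"
    "J * X = 0\<^sub>m n n"
proof -
  have n: "0 < n" and A: "A \<in> carrier_mat n n" and sym: "A\<^sup>T = A"
    and ker: "\<And>x. x \<in> carrier_vec n \<Longrightarrow> A *\<^sub>v x = 0\<^sub>v n \<longleftrightarrow> (\<exists>c. x = c \<cdot>\<^sub>v all_ones n)"
    using assms(1) by (auto simp: kernel_is_constants_def)
  have J: "J \<in> carrier_mat n n" and JT: "J\<^sup>T = J"
    by (auto simp: J_def)
  have JJ: "J * J = J"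
    using n by (auto simp: J_def scalar_prod_def)
  have ones: "A *\<^sub>v all_ones n = 0\<^sub>v n"
    using ker[of "all_ones n"] by (metis all_ones_carrier one_smult_vec)
  have AJ: "A * J = 0\<^sub>m n n"
  proof (rule eq_matI)
    fix i j assume ij: "i < dim_row (0\<^sub>m n n :: real mat)" "j < dim_col (0\<^sub>m n n :: real mat)"
    then have "(A * J) $$ (i, j) = (1 / real n) * ((A *\<^sub>v all_ones n) $ i)"
      using A by (simp add: J_def all_ones_def scalar_prod_def sum_divide_distrib)
    then show "(A * J) $$ (i, j) = 0\<^sub>m n n $$ (i, j)"
      using ij ones by simp
  qed (use A J in auto)
  have JA: "J * A = 0\<^sub>m n n"
    using arg_cong[OF AJ, of transpose_mat] transpose_mult[OF A J] sym JT by simp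
  define B where "B = A + J"
  have B: "B \<in> carrier_mat n n"
    using A J by (simp add: B_def)
  have BJ: "B * J = J" and JB: "J * B = J"
    using A J JJ AJ JA
    by (simp_all add: B_def add_mult_distrib_mat[of _ n n] mult_add_distrib_mat[of _ n n])
  have Jv: "J *\<^sub>v x = (all_ones n \<bullet> x / real n) \<cdot>\<^sub>v all_ones n" if "x \<in> carrier_vec n" for x
    using that
    by (intro eq_vecI) (auto simp: J_def all_ones_def scalar_prod_def sum_divide_distrib)
  \<comment> \<open>Since \<open>J * B = J\<close>, a kernel vector \<open>v\<close> of
    \<open>B\<close> has \<open>J v = 0\<close>, hence \<open>A v = 0\<close>; so \<open>v\<close>
    is a constant vector, which \<open>J\<close> fixes, and therefore 0.\<close>
  have "det B \<noteq> 0"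
  proof
    assume "det B = 0"
    then obtain v where v: "v \<in> carrier_vec n" "v \<noteq> 0\<^sub>v n" "B *\<^sub>v v = 0\<^sub>v n"
      using det_0_iff_vec_prod_zero[OF B] by auto
    have "J *\<^sub>v v = J *\<^sub>v (B *\<^sub>v v)"
      using JB assoc_mult_mat_vec[OF J B v(1)] by simp
    then have Jv0: "J *\<^sub>v v = 0\<^sub>v n"
      using v J by auto
    then have "A *\<^sub>v v = 0\<^sub>v n"
      using v(3) A J v(1) add_mult_distrib_mat_vec[OF A J v(1)] by (simp add: B_def)
    then obtain c where c: "v = c \<cdot>\<^sub>v all_ones n"
      using ker v by blast
    have "(J *\<^sub>v v) $ 0 = c"
      using Jv[OF v(1)] n
      by (simp add: c all_ones_def scalar_prod_def)
    then show False
      using v c Jv0 n by (auto simp: all_ones_def)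
  qed
  from det_non_zero_imp_unit[OF B this] obtain C where C: "C \<in> carrier_mat n n"
      and CB: "C * B = 1\<^sub>m n" and BC: "B * C = 1\<^sub>m n"
    unfolding Units_def by (auto simp: ring_mat_simps)
  have CJ: "C * J = J" and JC: "J * C = J"
    using assoc_mult_mat[OF C B J] assoc_mult_mat[OF J B C] BJ JB CB BC J by auto
  define X where "X = C - J"
  have X: "X \<in> carrier_mat n n"
    using C J by (auto simp: X_def)
  have JX: "J * X = 0\<^sub>m n n"
    using C J by (simp add: X_def mult_minus_distrib_mat[of _ n n] JC JJ)
  have "A * X = A * C"
    using A C J by (simp add: X_def mult_minus_distrib_mat[of _ n n] AJ) (intro eq_matI; simp)
  also have "\<dots> = B * C - J * C"
    using A C J by (simp add: B_def add_mult_distrib_mat[of _ n n]) (intro eq_matI; simp)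
  finally have AX: "A * X = 1\<^sub>m n - J"
    by (simp add: BC JC)
  have "X * A = C * A"
    using A C J by (simp add: X_def minus_mult_distrib_mat[of _ n n] JA) (intro eq_matI; simp)
  also have "\<dots> = C * B - C * J"
    using A C J by (simp add: B_def mult_add_distrib_mat[of _ n n]) (intro eq_matI; simp)
  finally have XA: "X * A = 1\<^sub>m n - J"
    by (simp add: CB CJ)
  have "(1\<^sub>m n - J)\<^sup>T = 1\<^sub>m n - J"
    using J JT by (simp add: transpose_minus[of _ n n])
  moreover have "(1\<^sub>m n - J) * A = A"
    using A J JA by (simp add: minus_mult_distrib_mat[of _ n n]) (intro eq_matI; simp)
  moreover have "(1\<^sub>m n - J) * X = X"
    using X J JX by (simp add: minus_mult_distrib_mat[of _ n n]) (intro eq_matI; simp)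
  ultimately have "is_pinv A X"
    using A X by (simp add: is_pinv_def AX XA)
  then show ?thesis
    using that X AX JX by blast
qed

text \<open>The equations \<open>A * X = 1 - J\<close> and \<open>J * X = 0\<close> read on vectors:
  on vectors of sum 0 the pseudo-inverse is a genuine right inverse, and its values again have sum
  0.\<close>

lemma pinv_kernel_is_constants:
  assumes ker: "kernel_is_constants n A"
  shows "pinv A \<in> carrier_mat n n"
    and "y \<in> carrier_vec n \<Longrightarrow> all_ones n \<bullet> y = 0 \<Longrightarrow> A *\<^sub>v (pinv A *\<^sub>v y) = y"
    and "y \<in> carrier_vec n \<Longrightarrow> all_ones n \<bullet> (pinv A *\<^sub>v y) = 0"
proof -
  define J where "J = mat n n (\<lambda>_. 1 / real n)"
  obtain X where X: "is_pinv A X" "X \<in> carrier_mat n n" "A * X = 1\<^sub>m n - J"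
    "J * X = 0\<^sub>m n n"
    using ex_is_pinv_kernel_is_constants[OF ker] unfolding J_def by metis
  have A: "A \<in> carrier_mat n n" and n: "0 < n"
    using ker by (auto simp: kernel_is_constants_def)
  have J: "J \<in> carrier_mat n n"
    by (simp add: J_def)
  have eq: "pinv A = X"
    using X(1) by (rule pinv_eqI)
  show "pinv A \<in> carrier_mat n n"
    by (simp add: eq X)
  have Jv: "J *\<^sub>v x = (all_ones n \<bullet> x / real n) \<cdot>\<^sub>v all_ones n" if "x \<in> carrier_vec n" for x
    using that
    by (intro eq_vecI) (auto simp: J_def all_ones_def scalar_prod_def sum_divide_distrib)
  show "A *\<^sub>v (pinv A *\<^sub>v y) = y" if y: "y \<in> carrier_vec n" "all_ones n \<bullet> y = 0"
  proof -
    have "A *\<^sub>v (pinv A *\<^sub>v y) = (1\<^sub>m n - J) *\<^sub>v y"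
      using A X y by (simp add: eq flip: assoc_mult_mat_vec)
    also have "\<dots> = y - J *\<^sub>v y"
      using J y by (subst minus_mult_distrib_mat_vec[of _ n n]) auto
    finally show ?thesis
      using y Jv[of y] by (auto intro!: eq_vecI simp: all_ones_def)
  qed
  show "all_ones n \<bullet> (pinv A *\<^sub>v y) = 0" if y: "y \<in> carrier_vec n"
  proof -
    have "J *\<^sub>v (X *\<^sub>v y) = 0\<^sub>v n"
      using X y J by (simp flip: assoc_mult_mat_vec) auto
    then have "(J *\<^sub>v (X *\<^sub>v y)) $ 0 = 0"
      using n by simp
    then show ?thesis
      using Jv[of "X *\<^sub>v y"] X(2) y n by (auto simp: eq all_ones_def)
  qed
qed

text \<open>Lets the outcome of the triangular solves be recognised as the pseudo-inverse applied to
  the residual. Two solutions differ by a multiple of the all-ones vector, and the vanishing sums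
  make that multiple 0.\<close>

lemma pinv_mult_vec_eqI:
  assumes ker: "kernel_is_constants n A" and x: "x \<in> carrier_vec n" "all_ones n \<bullet> x = 0"
    and "A *\<^sub>v x = y" and "all_ones n \<bullet> y = 0"
  shows "pinv A *\<^sub>v y = x"
proof -
  note p = pinv_kernel_is_constants[OF ker]
  have n: "0 < n" and A: "A \<in> carrier_mat n n"
    using ker by (auto simp: kernel_is_constants_def)
  have y: "y \<in> carrier_vec n"
    using assms(4) A x by auto
  define z where "z = pinv A *\<^sub>v y"
  have z: "z \<in> carrier_vec n" "all_ones n \<bullet> z = 0" "A *\<^sub>v z = y"
    using p y assms by (auto simp: z_def)
  have "A *\<^sub>v (z - x) = 0\<^sub>v n"
    using z x A y assms(4) by (simp add: mult_minus_distrib_mat_vec[of _ n n])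
  then obtain c where c: "z - x = c \<cdot>\<^sub>v all_ones n"
    using ker x z by (auto simp: kernel_is_constants_def)
  have "all_ones n \<bullet> (z - x) = 0"
    using z x by (simp add: scalar_prod_minus_distrib[of _ n])
  then have "c = 0"
    using n by (simp add: c all_ones_def scalar_prod_def)
  then have "z - x = 0\<^sub>v n"
    using c by (auto simp: all_ones_def)
  then have "z = x"
    using z x by (intro eq_vecI) (auto dest!: arg_cong[of _ _ "\<lambda>v. v $ _"] simp: vec_eq_iff)
  then show ?thesis
    by (simp add: z_def)
qed

section \<open>Laplacians\<close>

lemma laplacian_carrier [simp]: "laplacian n E \<in> carrier_mat n n"
  by (simp add: laplacian_def)

lemma laplacian_add_mset:
  "laplacian n (add_mset (u, v, w) E) =
     laplacian n E + mat n n (\<lambda>(i, j). w * ((unit_vec n v - unit_vec n u) $ i * (unit_vec n v - unit_vec n u) $ j))"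
  by (intro eq_matI) (auto simp: laplacian_def)

text \<open>With \<open>d = e_v - e_u\<close>, an edge adds the rank-one matrix
  \<open>w d d^T\<close>, whose form is the product of \<open>w\<close>, \<open>d . x\<close> and
  \<open>d . y\<close>.\<close>

lemma laplacian_bilinear_form:
  assumes "weighted_multigraph n E" and x: "x \<in> carrier_vec n" and y: "y \<in> carrier_vec n"
  shows "x \<bullet> (laplacian n E *\<^sub>v y) = (\<Sum>(u, v, w)\<in>#E. w * ((x $ v - x $ u) * (y $ v - y $ u)))"
proof -
  have "\<forall>(u, v, w)\<in>#E. u < n \<and> v < n"
    using assms(1) by (auto simp: weighted_multigraph_def)
  then show ?thesis
  proof (induction E)
    case empty
    have "laplacian n {#} = 0\<^sub>m n n"
      by (intro eq_matI) (auto simp: laplacian_def)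
    moreover have "(0\<^sub>m n n :: real mat) *\<^sub>v y = 0\<^sub>v n"
      using y by auto
    ultimately show ?case
      using x by simp
  next
    case (add e E)
    obtain u v w where e: "e = (u, v, w)"
      by (cases e)
    have uv: "u < n" "v < n"
      using add.prems by (auto simp: e)
    let ?d = "unit_vec n v - unit_vec n u :: real vec"
    let ?R = "mat n n (\<lambda>(i, j). w * (?d $ i * ?d $ j))"
    have d: "?d \<in> carrier_vec n"
      by simp
    have dz: "?d \<bullet> z = z $ v - z $ u" if "z \<in> carrier_vec n" for z
      using that uv by (simp add: minus_scalar_prod_distrib[of _ n])
    have "?R *\<^sub>v y = (w * (?d \<bullet> y)) \<cdot>\<^sub>v ?d"
      using y
      by (intro eq_vecI) (auto simp: scalar_prod_def sum_distrib_left sum_distrib_right algebra_simps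
            intro!: sum.cong)
    then have R: "x \<bullet> (?R *\<^sub>v y) = w * ((x $ v - x $ u) * (y $ v - y $ u))"
      using x y d dz by (simp add: scalar_prod_smult_distrib[of _ n] comm_scalar_prod[of x n])
    have "x \<bullet> (laplacian n (add_mset e E) *\<^sub>v y) = x \<bullet> (laplacian n E *\<^sub>v y) + x \<bullet> (?R *\<^sub>v y)"
      unfolding e laplacian_add_mset using x y
      by (subst add_mult_distrib_mat_vec[of _ n n])
         (auto intro!: scalar_prod_add_distrib[of _ n] mult_mat_vec_carrier[of _ n n])
    then show ?case
      using add R by (simp add: e)
  qed
qed

lemma laplacian_symmetric: "(laplacian n E)\<^sup>T = laplacian n E"
  by (intro eq_matI) (auto simp: laplacian_def mult.commute intro!: arg_cong[of _ _ sum_mset] image_mset_cong)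

lemma sum_mset_nonneg_real:
  fixes f :: "'a \<Rightarrow> real"
  assumes "\<And>e. e \<in># E \<Longrightarrow> 0 \<le> f e"
  shows "0 \<le> (\<Sum>e\<in>#E. f e)"
  using assms by (induction E) auto

lemma psd_laplacian:
  assumes "weighted_multigraph n E"
  shows "psd (laplacian n E)"
proof -
  have "0 \<le> x \<bullet> (laplacian n E *\<^sub>v x)" if "x \<in> carrier_vec n" for x
    unfolding laplacian_bilinear_form[OF assms that that]
    using assms by (intro sum_mset_nonneg_real) (auto simp: weighted_multigraph_def)
  then show ?thesis
    by (simp add: psd_def laplacian_symmetric) (simp add: laplacian_def)
qed

text \<open>All summands of the form are non-negative, so each one vanishes and \<open>x\<close>
  agrees at both ends of every edge; connectivity spreads the common value along paths.\<close>

lemma laplacian_form_eq_0: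
  assumes "connected_multigraph n E" and x: "x \<in> carrier_vec n"
    and z: "x \<bullet> (laplacian n E *\<^sub>v x) = 0"
  shows "\<exists>c. x = c \<cdot>\<^sub>v all_ones n"
proof -
  have wm: "weighted_multigraph n E"
    using assms by (simp add: connected_multigraph_def)
  have edge: "x $ u = x $ v" if e: "(u, v, w) \<in># E" for u v w
  proof -
    obtain E' where E': "E = add_mset (u, v, w) E'"
      using multi_member_split[OF e] by blast
    have w: "0 < w" and nn: "0 \<le> (\<Sum>(u, v, w)\<in>#E'. w * ((x $ v - x $ u) * (x $ v - x $ u)))"
      using wm by (auto simp: E' weighted_multigraph_def intro!: sum_mset_nonneg_real)
    have "w * ((x $ v - x $ u) * (x $ v - x $ u)) \<le> 0"
      using z nn unfolding laplacian_bilinear_form[OF wm x x] by (simp add: E')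
    then have "(x $ v - x $ u) * (x $ v - x $ u) \<le> 0"
      using w by (simp add: mult_le_0_iff)
    then show ?thesis
      by (auto simp: mult_le_0_iff)
  qed
  have "x $ u = x $ v" if "(u, v) \<in> (adjacency E)\<^sup>*" for u v
    using that
  proof induction
    case (step v w)
    from step(2) have "x $ v = x $ w"
      by (auto simp: adjacency_def dest: edge)
    then show ?case
      using step by simp
  qed simp
  moreover have "0 < n"
    using wm by (simp add: weighted_multigraph_def)
  ultimately have const: "x $ i = x $ 0" if "i < n" for i
    using assms(1) that by (simp add: connected_multigraph_def)
  have "x = (x $ 0) \<cdot>\<^sub>v all_ones n"
  proof (rule eq_vecI)
    show "x $ i = ((x $ 0) \<cdot>\<^sub>v all_ones n) $ i" if "i < dim_vec ((x $ 0) \<cdot>\<^sub>v all_ones n)" for i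
      using const[of i] that by (simp add: all_ones_def)
  qed (use x in \<open>simp add: all_ones_def\<close>)
  then show ?thesis ..
qed

lemma laplacian_mult_all_ones:
  assumes "weighted_multigraph n E"
  shows "laplacian n E *\<^sub>v (c \<cdot>\<^sub>v all_ones n) = 0\<^sub>v n"
proof -
  have "(c \<cdot>\<^sub>v all_ones n) \<bullet> (laplacian n E *\<^sub>v (c \<cdot>\<^sub>v all_ones n)) = 0"
    using assms
    by (subst laplacian_bilinear_form)
       (fastforce simp: weighted_multigraph_def all_ones_def intro!: sum_mset.neutral)+
  then show ?thesis
    by (intro psd_form_eq_0 psd_laplacian assms laplacian_carrier) auto
qed

lemma kernel_is_constants_laplacian:
  assumes "connected_multigraph n E"
  shows "kernel_is_constants n (laplacian n E)"
proof -
  have wm: "weighted_multigraph n E"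
    using assms by (simp add: connected_multigraph_def)
  then show ?thesis
    using laplacian_form_eq_0[OF assms] laplacian_mult_all_ones[OF wm]
    by (auto simp: kernel_is_constants_def laplacian_symmetric weighted_multigraph_def)
qed

text \<open>A positive semidefinite matrix kills exactly the zeros of its form, and the two bounds
  give the forms of \<open>L\<close> and \<open>Z\<close> the same zeros. Symmetry of
  \<open>Z\<close> comes with the lower bound, since \<open>psd\<close> includes it for
  \<open>Z - L/2\<close>.\<close>

lemma kernel_is_constants_sandwiched:
  fixes L Z :: "real mat"
  assumes L: "kernel_is_constants n L" "psd L" and Z: "Z \<in> carrier_mat n n"
    and lo: "loewner_le ((1/2) \<cdot>\<^sub>m L) Z" and hi: "loewner_le Z ((3/2) \<cdot>\<^sub>m L)"
  shows "kernel_is_constants n Z"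
    and "\<And>x. x \<in> carrier_vec n \<Longrightarrow> x \<bullet> (L *\<^sub>v x) \<le> 2 * (x \<bullet> (Z *\<^sub>v x))"
    and "\<And>x. x \<in> carrier_vec n \<Longrightarrow> 2 * (x \<bullet> (Z *\<^sub>v x)) \<le> 3 * (x \<bullet> (L *\<^sub>v x))"
proof -
  have Lc: "L \<in> carrier_mat n n" and Ls: "L\<^sup>T = L" and n: "0 < n"
    and ker: "\<And>x. x \<in> carrier_vec n \<Longrightarrow> L *\<^sub>v x = 0\<^sub>v n \<longleftrightarrow> (\<exists>c. x = c \<cdot>\<^sub>v all_ones n)"
    using L by (auto simp: kernel_is_constants_def)
  have form: "x \<bullet> ((A - B) *\<^sub>v x) = x \<bullet> (A *\<^sub>v x) - x \<bullet> (B *\<^sub>v x)"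
    if "x \<in> carrier_vec n" "A \<in> carrier_mat n n" "B \<in> carrier_mat n n" for x and A B :: "real mat"
    using that by (simp add: minus_mult_distrib_mat_vec[of _ n n] scalar_prod_minus_distrib[of _ n])
  have sform: "x \<bullet> ((a \<cdot>\<^sub>m A) *\<^sub>v x) = a * (x \<bullet> (A *\<^sub>v x))"
    if "x \<in> carrier_vec n" "A \<in> carrier_mat n n" for a x and A :: "real mat"
  proof -
    have "(a \<cdot>\<^sub>m A) *\<^sub>v x = a \<cdot>\<^sub>v (A *\<^sub>v x)"
      using that by (intro eq_vecI) (auto simp: scalar_prod_def sum_distrib_left mult.assoc)
    then show ?thesis
      using that by (simp add: scalar_prod_smult_distrib[of _ n])
  qed
  show lo': "x \<bullet> (L *\<^sub>v x) \<le> 2 * (x \<bullet> (Z *\<^sub>v x))" if "x \<in> carrier_vec n" for x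
  proof -
    have "0 \<le> x \<bullet> ((Z - (1/2) \<cdot>\<^sub>m L) *\<^sub>v x)"
      using lo Lc Z that by (auto simp: loewner_le_def psd_def)
    then show ?thesis
      using that Lc Z by (simp add: form sform)
  qed
  show hi': "2 * (x \<bullet> (Z *\<^sub>v x)) \<le> 3 * (x \<bullet> (L *\<^sub>v x))" if "x \<in> carrier_vec n" for x
  proof -
    have "0 \<le> x \<bullet> (((3/2) \<cdot>\<^sub>m L - Z) *\<^sub>v x)"
      using hi Lc Z that by (auto simp: loewner_le_def psd_def)
    then show ?thesis
      using that Lc Z by (simp add: form sform)
  qed
  have "Z\<^sup>T = Z"
  proof (rule eq_matI)
    fix i j assume ij: "i < dim_row Z" "j < dim_col Z"
    have "(Z - (1/2) \<cdot>\<^sub>m L)\<^sup>T $$ (i, j) = (Z - (1/2) \<cdot>\<^sub>m L) $$ (i, j)"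
      using lo by (simp add: loewner_le_def psd_def)
    moreover have "L $$ (j, i) = L $$ (i, j)"
      using arg_cong[OF Ls, of "\<lambda>A. A $$ (i, j)"] Lc Z ij by simp
    ultimately show "Z\<^sup>T $$ (i, j) = Z $$ (i, j)"
      using Lc Z ij by simp
  qed (use Z in auto)
  moreover have nnL: "0 \<le> x \<bullet> (L *\<^sub>v x)" if "x \<in> carrier_vec n" for x
    using L(2) Lc that by (auto simp: psd_def)
  ultimately have "psd Z"
    using Z lo' by (fastforce simp: psd_def)
  have "Z *\<^sub>v x = 0\<^sub>v n \<longleftrightarrow> L *\<^sub>v x = 0\<^sub>v n" if x: "x \<in> carrier_vec n" for x
  proof
    assume "Z *\<^sub>v x = 0\<^sub>v n"
    then have "x \<bullet> (L *\<^sub>v x) = 0"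
      using lo'[OF x] nnL[OF x] x by simp
    then show "L *\<^sub>v x = 0\<^sub>v n"
      using psd_form_eq_0[OF Lc L(2) x] by simp
  next
    assume "L *\<^sub>v x = 0\<^sub>v n"
    then have "x \<bullet> (Z *\<^sub>v x) = 0"
      using hi'[OF x] lo'[OF x] x by simp
    then show "Z *\<^sub>v x = 0\<^sub>v n"
      using psd_form_eq_0[OF Z \<open>psd Z\<close> x] by simp
  qed
  then show "kernel_is_constants n Z"
    using ker n Z \<open>Z\<^sup>T = Z\<close> by (simp add: kernel_is_constants_def)
qed

section \<open>Contraction of the iteration\<close>

text \<open>Applied to the error of an iterate. The forms are compared in squared shape, so the
  factor 2/3 appears as 4/9 and a square root is taken only once, when the norm is formed.\<close>

lemma richardson_step_contracts:
  fixes L Z :: "real mat"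
  assumes L: "kernel_is_constants n L" and Z: "kernel_is_constants n Z"
    and nn: "\<And>x. x \<in> carrier_vec n \<Longrightarrow> 0 \<le> x \<bullet> (L *\<^sub>v x)"
    and lo: "\<And>x. x \<in> carrier_vec n \<Longrightarrow> x \<bullet> (L *\<^sub>v x) \<le> 2 * (x \<bullet> (Z *\<^sub>v x))"
    and hi: "\<And>x. x \<in> carrier_vec n \<Longrightarrow> 2 * (x \<bullet> (Z *\<^sub>v x)) \<le> 3 * (x \<bullet> (L *\<^sub>v x))"
    and e: "e \<in> carrier_vec n"
  defines "e' \<equiv> e - (1/2) \<cdot>\<^sub>v (pinv Z *\<^sub>v (L *\<^sub>v e))"
  shows "9 * (e' \<bullet> (L *\<^sub>v e')) \<le> 4 * (e \<bullet> (L *\<^sub>v e))"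
proof -
  define W where "W f = pinv Z *\<^sub>v (L *\<^sub>v f)" for f
  define a where "a f g = f \<bullet> (L *\<^sub>v g)" for f g
  note pz = pinv_kernel_is_constants[OF Z]
  have Lc: "L \<in> carrier_mat n n" and Ls: "L\<^sup>T = L" and Zc: "Z \<in> carrier_mat n n"
    and Zs: "Z\<^sup>T = Z"
    using L Z by (auto simp: kernel_is_constants_def)
  have Wc [simp]: "W f \<in> carrier_vec n" if "f \<in> carrier_vec n" for f
    using that pz(1) Lc by (auto simp: W_def)
  have L1: "L *\<^sub>v all_ones n = 0\<^sub>v n"
    using L unfolding kernel_is_constants_def by (metis all_ones_carrier one_smult_vec)
  \<comment> \<open>\<open>L f\<close> has sum 0, and on such vectors \<open>Z\<close> undoes
    \<open>pinv Z\<close>.\<close>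
  have ZW: "Z *\<^sub>v W f = L *\<^sub>v f" if f: "f \<in> carrier_vec n" for f
  proof -
    have "all_ones n \<bullet> (L *\<^sub>v f) = 0"
      using symmetric_form_commute[OF Lc Ls all_ones_carrier f] f by (simp add: L1)
    then show ?thesis
      using pz(2) Lc f by (auto simp: W_def)
  qed
  have Wlin: "W (c \<cdot>\<^sub>v f + d \<cdot>\<^sub>v g) = c \<cdot>\<^sub>v W f + d \<cdot>\<^sub>v W g"
    if "f \<in> carrier_vec n" "g \<in> carrier_vec n" for c d f g
    using that pz(1) Lc
    by (simp add: W_def mult_add_distrib_mat_vec[of _ n n] mult_mat_vec[of _ n n])
  have alin: "a h (c \<cdot>\<^sub>v f + d \<cdot>\<^sub>v g) = c * a h f + d * a h g"
    "a (c \<cdot>\<^sub>v f + d \<cdot>\<^sub>v g) h = c * a f h + d * a g h"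
    if "f \<in> carrier_vec n" "g \<in> carrier_vec n" "h \<in> carrier_vec n" for c d f g h
    using form_add_smult[OF Lc that] by (simp_all add: a_def)
  have asym: "a f g = a g f" if "f \<in> carrier_vec n" "g \<in> carrier_vec n" for f g
    using symmetric_form_commute[OF Lc Ls that] by (simp add: a_def)
  have Wadj: "a (W f) g = a f (W g)" if "f \<in> carrier_vec n" "g \<in> carrier_vec n" for f g
  proof -
    have "a (W f) g = W f \<bullet> (Z *\<^sub>v W g)"
      using ZW that by (simp add: a_def)
    also have "\<dots> = W g \<bullet> (Z *\<^sub>v W f)"
      using that by (intro symmetric_form_commute[OF Zc Zs]) auto
    also have "\<dots> = a (W g) f"
      using ZW that by (simp add: a_def)
    finally show ?thesis
      using asym that by simp
  qed
  \<comment> \<open>The test vectors \<open>f - W f / 2\<close> and \<open>f - 3/2 W f\<close>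
    vanish on eigenvectors of \<open>W\<close> for the extreme eigenvalues 2 and 2/3. The first is
    put into the form of \<open>L\<close>, the second into that of \<open>Z\<close>; a Loewner bound
    then eliminates \<open>a (W f) (W f)\<close> in the one case and \<open>f . Z f\<close> in the
    other.\<close>
  have W_bounds: "2 * a f f \<le> 3 * a f (W f)" "a f (W f) \<le> 2 * a f f" if f: "f \<in> carrier_vec n" for f
  proof -
    define q where "q = a f (W f)"
    have ZWq: "W f \<bullet> (Z *\<^sub>v W f) = q" "f \<bullet> (Z *\<^sub>v W f) = a f f" "W f \<bullet> (Z *\<^sub>v f) = a f f"
      using f ZW asym symmetric_form_commute[OF Zc Zs, of "W f" f] by (simp_all add: q_def a_def)
    let ?u = "1 \<cdot>\<^sub>v f + (-1/2) \<cdot>\<^sub>v W f"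
    have "0 \<le> a ?u ?u"
      using nn[of ?u] f by (simp add: a_def)
    also have "a ?u ?u = a f f - q + a (W f) (W f) / 4"
      using f asym[of "W f" f] by (simp only: alin Wc q_def smult_carrier_vec add_carrier_vec) (simp add: field_simps)
    finally have "0 \<le> a f f - q + a (W f) (W f) / 4" .
    moreover have "a (W f) (W f) \<le> 2 * q"
      using lo[of "W f"] f ZWq by (simp add: a_def)
    ultimately show "a f (W f) \<le> 2 * a f f"
      unfolding q_def by linarith
    let ?v = "1 \<cdot>\<^sub>v f + (-3/2) \<cdot>\<^sub>v W f"
    have v: "?v \<in> carrier_vec n"
      using f by simp
    have "0 \<le> ?v \<bullet> (Z *\<^sub>v ?v)"
      using lo[OF v] nn[OF v] by linarith
    also have "?v \<bullet> (Z *\<^sub>v ?v) = f \<bullet> (Z *\<^sub>v f) - 3 * a f f + 9/4 * q"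
      using f by (simp only: form_add_smult[OF Zc _ _ v] form_add_smult[OF Zc f Wc f]
          form_add_smult[OF Zc f Wc Wc] Wc ZWq) (simp add: field_simps)
    finally show "2 * a f f \<le> 3 * a f (W f)"
      using hi[OF f] unfolding q_def a_def[of f f] by linarith
  qed
  define g h where "g = W e" and "h = W g"
  have [simp]: "g \<in> carrier_vec n" "h \<in> carrier_vec n"
    using e by (auto simp: g_def h_def)
  have Wf: "W (c \<cdot>\<^sub>v e + d \<cdot>\<^sub>v g) = c \<cdot>\<^sub>v g + d \<cdot>\<^sub>v h" for c d
    using Wlin e by (simp add: g_def h_def)
  have eh: "a e h = a g g"
    using Wadj[OF e \<open>g \<in> _\<close>] by (simp add: g_def[symmetric] h_def)
  have ge: "a g e = a e g"
    using asym e by simp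
  note bl = alin[OF e \<open>g \<in> _\<close>] alin[OF \<open>g \<in> _\<close> \<open>h \<in> _\<close>]
  \<comment> \<open>Self-adjointness reduces all forms on the span of \<open>e\<close> and
    \<open>W e\<close> to \<open>a e e\<close>, \<open>a e g\<close>, \<open>a g g\<close> and
    \<open>a g h\<close>, the moments of orders 0 to 3 of the spectral measure of
    \<open>e\<close>.\<close>
  have form: "a (c \<cdot>\<^sub>v e + d \<cdot>\<^sub>v g) (c \<cdot>\<^sub>v e + d \<cdot>\<^sub>v g)
      = c * c * a e e + 2 * c * d * a e g + d * d * a g g"
    and formW: "a (c \<cdot>\<^sub>v e + d \<cdot>\<^sub>v g) (W (c \<cdot>\<^sub>v e + d \<cdot>\<^sub>v g))
      = c * c * a e g + 2 * c * d * a g g + d * d * a g h" for c d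
    using e by (simp_all add: bl Wf ge eh algebra_simps)
  have f: "c \<cdot>\<^sub>v e + d \<cdot>\<^sub>v g \<in> carrier_vec n" for c d
    using e by simp
  note B = W_bounds[OF f, unfolded form formW]
  \<comment> \<open>\<open>W\<close> is self-adjoint for \<open>a\<close> with spectrum in \<open>[2/3, 2]\<close>, where
    \<open>4/9 - (1 - t/2)\<^sup>2 = (t/2 - 1/3) (1 - t/2) + 2/3 (t/2 - 1/3)\<close> is non-negative; the product is
    a combination of \<open>(1 - t/2)\<^sup>2 (t - 2/3)\<close> and \<open>(t/2 - 1/3)\<^sup>2 (2 - t)\<close>.\<close>
  have "9 * a (1 \<cdot>\<^sub>v e + (-1/2) \<cdot>\<^sub>v g) (1 \<cdot>\<^sub>v e + (-1/2) \<cdot>\<^sub>v g) \<le> 4 * a e e"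
    unfolding form using B(1)[of 1 0] B(1)[of 1 "-1/2"] B(2)[of "-1/3" "1/2"] by (simp add: field_simps)
  moreover have "e' = 1 \<cdot>\<^sub>v e + (-1/2) \<cdot>\<^sub>v g"
    using e \<open>g \<in> _\<close> unfolding e'_def g_def W_def by (intro eq_vecI) auto
  ultimately show ?thesis
    by (simp add: a_def)
qed

text \<open>As \<open>L\<close> maps \<open>pinv L *\<^sub>v b\<close> back to \<open>b\<close>, the
  error obeys the homogeneous recursion of the contraction lemma, and at step 0 it is minus the
  solution.\<close>

lemma lap_norm_iterate:
  fixes L Z :: "real mat"
  assumes L: "kernel_is_constants n L" and Z: "kernel_is_constants n Z"
    and nn: "\<And>x. x \<in> carrier_vec n \<Longrightarrow> 0 \<le> x \<bullet> (L *\<^sub>v x)"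
    and lo: "\<And>x. x \<in> carrier_vec n \<Longrightarrow> x \<bullet> (L *\<^sub>v x) \<le> 2 * (x \<bullet> (Z *\<^sub>v x))"
    and hi: "\<And>x. x \<in> carrier_vec n \<Longrightarrow> 2 * (x \<bullet> (Z *\<^sub>v x)) \<le> 3 * (x \<bullet> (L *\<^sub>v x))"
    and b: "b \<in> carrier_vec n" "all_ones n \<bullet> b = 0"
  shows "iterate L Z b t \<in> carrier_vec n \<and>
    lap_norm L (iterate L Z b t - pinv L *\<^sub>v b) \<le> (2/3) ^ t * lap_norm L (pinv L *\<^sub>v b)"
proof (induction t)
  case 0
  have Lc: "L \<in> carrier_mat n n" and px: "pinv L *\<^sub>v b \<in> carrier_vec n"
    using L pinv_kernel_is_constants(1)[OF L] b by (auto simp: kernel_is_constants_def)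
  define p where "p = pinv L *\<^sub>v b"
  have p: "p \<in> carrier_vec n"
    using px by (simp add: p_def)
  have eq: "0\<^sub>v n - p = (-1) \<cdot>\<^sub>v p + 0 \<cdot>\<^sub>v p"
    using p by (intro eq_vecI) auto
  have c: "(-1) \<cdot>\<^sub>v p + 0 \<cdot>\<^sub>v p \<in> carrier_vec n"
    using p by simp
  have "(0\<^sub>v n - p) \<bullet> (L *\<^sub>v (0\<^sub>v n - p)) = p \<bullet> (L *\<^sub>v p)"
    unfolding eq form_add_smult(1)[OF Lc p p c] form_add_smult(2)[OF Lc p p p] by simp
  then show ?case
    using Lc by (simp add: lap_norm_def p_def)
next
  case (Suc t)
  let ?x = "iterate L Z b t"
  have Lc: "L \<in> carrier_mat n n"
    using L by (auto simp: kernel_is_constants_def)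
  define p where "p = pinv L *\<^sub>v b"
  have p: "p \<in> carrier_vec n" "L *\<^sub>v p = b"
    using pinv_kernel_is_constants[OF L] b by (auto simp: p_def)
  note pz = pinv_kernel_is_constants[OF Z]
  define e where "e = ?x - p"
  have x: "?x \<in> carrier_vec n" and e: "e \<in> carrier_vec n"
    using Suc p by (auto simp: e_def)
  have Le: "L *\<^sub>v e = L *\<^sub>v ?x - b"
    using x p Lc by (simp add: e_def mult_minus_distrib_mat_vec[of _ n n])
  define s where "s = pinv Z *\<^sub>v (L *\<^sub>v e)"
  have s: "s \<in> carrier_vec n"
    using pz Lc e by (auto simp: s_def intro!: mult_mat_vec_carrier[of _ n n])
  let ?e' = "e - (1/2) \<cdot>\<^sub>v s"
  have xS: "iterate L Z b (Suc t) = ?x - (1/2) \<cdot>\<^sub>v s"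
    by (simp add: s_def Le)
  have e': "iterate L Z b (Suc t) - p = ?e'"
    unfolding xS e_def using x s p by (intro eq_vecI) (auto simp: e_def)
  have "9 * (?e' \<bullet> (L *\<^sub>v ?e')) \<le> 4 * (e \<bullet> (L *\<^sub>v e))"
    using richardson_step_contracts[OF L Z nn lo hi e] by (simp add: s_def)
  then have "?e' \<bullet> (L *\<^sub>v ?e') \<le> (2/3)\<^sup>2 * (e \<bullet> (L *\<^sub>v e))"
    by (simp add: power2_eq_square)
  then have "lap_norm L ?e' \<le> 2/3 * lap_norm L e"
    unfolding lap_norm_def by (drule_tac real_sqrt_le_mono) (simp add: real_sqrt_mult)
  also have "\<dots> \<le> 2/3 * ((2/3) ^ t * lap_norm L p)"
    using Suc by (intro mult_left_mono) (auto simp: e_def p_def)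
  finally have "lap_norm L (iterate L Z b (Suc t) - p) \<le> (2/3) ^ Suc t * lap_norm L p"
    unfolding e' by simp
  moreover have "iterate L Z b (Suc t) \<in> carrier_vec n"
    unfolding xS using x s by simp
  ultimately show ?case
    by (simp add: p_def)
qed

text \<open>The bound \<open>exp x \<le> 1 + x + x^2\<close> at \<open>1/3\<close> gives
  \<open>exp (1/3) \<le> 13/9 < 3/2\<close>, so every step is worth a factor
  \<open>exp (-1/3)\<close>; hence the 3 in the number of steps.\<close>

lemma power_num_iterations:
  assumes "0 < \<epsilon>"
  shows "(2/3 :: real) ^ num_iterations \<epsilon> \<le> \<epsilon>"
proof -
  let ?t = "num_iterations \<epsilon>"
  have t: "3 * ln (1 / \<epsilon>) \<le> real ?t"
    unfolding num_iterations_def by linarith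
  have "exp (1/3 :: real) \<le> 3/2"
    using exp_bound[of "1/3"] by (simp add: power2_eq_square)
  then have "2/3 * exp (1/3 :: real) \<le> 1"
    by simp
  then have "2/3 \<le> exp (- (1/3) :: real)"
    by (simp add: exp_minus field_simps)
  then have "(2/3) ^ ?t \<le> exp (- (1/3) :: real) ^ ?t"
    by (intro power_mono) auto
  also have "\<dots> = exp (- (real ?t / 3))"
    by (simp add: exp_of_nat_mult[symmetric])
  also have "\<dots> \<le> exp (ln \<epsilon>)"
    using t assms by (subst exp_le_cancel_iff) (simp add: ln_div)
  finally show ?thesis
    using assms by simp
qed

section \<open>Solving a factored system\<close>

lemma sum_mult_eq_single:
  fixes f g :: "nat \<Rightarrow> real"
  assumes "\<And>j. j < n \<Longrightarrow> j \<noteq> i \<Longrightarrow> f j = 0" "i < n"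
  shows "(\<Sum>j<n. f j * g j) = f i * g i"
proof -
  have "(\<Sum>j<n. f j * g j) = (\<Sum>j\<in>{i}. f j * g j)"
    using assms by (intro sum.mono_neutral_right) auto
  then show ?thesis
    by simp
qed

lemma index_mult_mat_vec_sum:
  "A \<in> carrier_mat n k \<Longrightarrow> x \<in> carrier_vec k \<Longrightarrow> i < n \<Longrightarrow> (A *\<^sub>v x) $ i = (\<Sum>j<k. A $$ (i, j) * x $ j)"
  by (auto simp: scalar_prod_def lessThan_atLeast0)

text \<open>Reading \<open>x\<close> in the coordinates permuted by \<open>p\<close> absorbs both
  permutation matrices: \<open>P^T x\<close> is \<open>v\<close>, and row \<open>i\<close> of
  \<open>P\<close> selects entry \<open>p i\<close>. What is left is \<open>M D M^T\<close> applied
  to \<open>v\<close>, with \<open>D\<close> reduced to its diagonal.\<close>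

lemma factored_mult_vec:
  fixes M D :: "real mat"
  assumes p: "p permutes {..<n}" and P: "P = mat n n (\<lambda>(i, j). if j = p i then 1 else 0)"
    and M: "M \<in> carrier_mat n n" and D: "D \<in> carrier_mat n n" "diagonal_mat D"
    and x: "x \<in> carrier_vec n" and xv: "\<And>i. i < n \<Longrightarrow> x $ i = v (p i)" and i: "i < n"
  shows "(factored P M D *\<^sub>v x) $ i = (\<Sum>j<n. M $$ (p i, j) * (D $$ (j, j) * (\<Sum>k<n. M $$ (k, j) * v k)))"
proof -
  have Pc: "P \<in> carrier_mat n n"
    by (simp add: P)
  have pn: "p j < n" if "j < n" for j
    using permutes_in_image[OF p, of j] that by simp
  define V where "V = vec n v"
  have V: "V \<in> carrier_vec n"
    by (simp add: V_def)
  have "P\<^sup>T *\<^sub>v x = V"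
  proof (rule eq_vecI)
    fix k assume "k < dim_vec V"
    then have k: "k < n"
      by (simp add: V_def)
    then obtain j where j: "j < n" "p j = k"
      using permutes_image[OF p] by (metis imageE lessThan_iff)
    have "(P\<^sup>T *\<^sub>v x) $ k = (\<Sum>l<n. P\<^sup>T $$ (k, l) * x $ l)"
      using Pc x k by (intro index_mult_mat_vec_sum[of _ n]) auto
    also have "\<dots> = P\<^sup>T $$ (k, j) * x $ j"
      using j k permutes_inj[OF p] by (intro sum_mult_eq_single) (auto simp: P inj_def)
    finally show "(P\<^sup>T *\<^sub>v x) $ k = V $ k"
      using j k xv by (simp add: P V_def)
  qed (simp add: P V_def)
  moreover have "P * M \<in> carrier_mat n n" "P * M * D \<in> carrier_mat n n"
    "P * M * D * M\<^sup>T \<in> carrier_mat n n"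
    using Pc M D by (auto intro!: mult_carrier_mat[of _ n n])
  ultimately have "factored P M D *\<^sub>v x = P *\<^sub>v (M *\<^sub>v (D *\<^sub>v (M\<^sup>T *\<^sub>v V)))"
    using Pc M D x V unfolding factored_def
    by (simp add: assoc_mult_mat_vec[of _ n n _ n] del: assoc_mult_mat)
  also have "\<dots> $ i = (\<Sum>j<n. P $$ (i, j) * (M *\<^sub>v (D *\<^sub>v (M\<^sup>T *\<^sub>v V))) $ j)"
    using Pc M i by (intro index_mult_mat_vec_sum[of _ n]) (auto intro!: carrier_vecI)
  also have "\<dots> = P $$ (i, p i) * (M *\<^sub>v (D *\<^sub>v (M\<^sup>T *\<^sub>v V))) $ p i"
    using pn i by (intro sum_mult_eq_single) (auto simp: P)
  also have "\<dots> = (M *\<^sub>v (D *\<^sub>v (M\<^sup>T *\<^sub>v V))) $ p i"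
    using pn i by (simp add: P)
  also have "\<dots> = (\<Sum>j<n. M $$ (p i, j) * (D *\<^sub>v (M\<^sup>T *\<^sub>v V)) $ j)"
    using M D V pn i by (intro index_mult_mat_vec_sum[of _ n]) auto
  also have "\<dots> = (\<Sum>j<n. M $$ (p i, j) * (D $$ (j, j) * (\<Sum>k<n. M $$ (k, j) * v k)))"
  proof (intro sum.cong refl arg_cong2[of _ _ _ _ "(*)"])
    fix j assume "j \<in> {..<n}"
    then have j: "j < n"
      by simp
    have "(D *\<^sub>v (M\<^sup>T *\<^sub>v V)) $ j = (\<Sum>k<n. D $$ (j, k) * (M\<^sup>T *\<^sub>v V) $ k)"
      using M D V j by (intro index_mult_mat_vec_sum[of _ n]) auto
    also have "\<dots> = D $$ (j, j) * (M\<^sup>T *\<^sub>v V) $ j"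
      using D j by (intro sum_mult_eq_single) (auto simp: diagonal_mat_def)
    also have "(M\<^sup>T *\<^sub>v V) $ j = (\<Sum>k<n. M\<^sup>T $$ (j, k) * V $ k)"
      using M V j by (intro index_mult_mat_vec_sum[of _ n]) auto
    also have "\<dots> = (\<Sum>k<n. M $$ (k, j) * v k)"
      using M j by (intro sum.cong) (auto simp: V_def)
    finally show "(D *\<^sub>v (M\<^sup>T *\<^sub>v V)) $ j = D $$ (j, j) * (\<Sum>k<n. M $$ (k, j) * v k)" .
  qed
  finally show ?thesis .
qed

text \<open>A zero among the first \<open>n - 1\<close> pivots leaves room for a non-zero
  \<open>u\<close> with last entry 0 and \<open>D M^T u = 0\<close>. Up to the permutation it lies
  in the kernel of \<open>Z\<close>, so it is constant, and its last entry makes it 0.\<close>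

lemma factored_pivot_nonzero:
  fixes M D :: "real mat"
  assumes p: "p permutes {..<n}" and P: "P = mat n n (\<lambda>(i, j). if j = p i then 1 else 0)"
    and M: "M \<in> carrier_mat n n" "lower_triangular M" and D: "D \<in> carrier_mat n n" "diagonal_mat D"
    and Z: "kernel_is_constants n (factored P M D)" and i: "Suc i < n"
  shows "M $$ (i, i) * D $$ (i, i) \<noteq> 0"
proof
  assume zero: "M $$ (i, i) * D $$ (i, i) = 0"
  have M0: "M $$ (k, j) = 0" if "k < j" "j < n" for k j
    using M that by (auto simp: lower_triangular_def)
  \<comment> \<open>\<open>T\<close> is \<open>D M^T\<close> with the last row replaced by the last
    unit vector. It is upper triangular because \<open>M\<close> is lower triangular, the assumed
    zero sits on its diagonal, and the new row forces its kernel vectors to end in 0.\<close>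
  define T where "T = mat n n (\<lambda>(j, k). if Suc j < n then D $$ (j, j) * M $$ (k, j) else if k = j then 1 else 0)"
  have T: "T \<in> carrier_mat n n"
    by (simp add: T_def)
  have "upper_triangular T"
    using M0 by (auto simp: upper_triangular_def T_def)
  then have "det T = (\<Prod>j = 0..<n. T $$ (j, j))"
    using det_upper_triangular[OF _ T] T by (simp add: prod_list_diag_prod)
  also have "\<dots> = 0"
    using zero i by (intro prod_zero) (auto simp: T_def intro!: bexI[of _ i])
  finally obtain u where u: "u \<in> carrier_vec n" "u \<noteq> 0\<^sub>v n" "T *\<^sub>v u = 0\<^sub>v n"
    using det_0_iff_vec_prod_zero[OF T] by auto
  have Tu: "(\<Sum>k<n. T $$ (j, k) * u $ k) = 0" if "j < n" for j
    using index_mult_mat_vec_sum[OF T u(1) that] u(3) that by simp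
  have last: "u $ (n - 1) = 0"
  proof -
    have "(\<Sum>k<n. T $$ (n - 1, k) * u $ k) = T $$ (n - 1, n - 1) * u $ (n - 1)"
      using i by (intro sum_mult_eq_single) (auto simp: T_def)
    then show ?thesis
      using Tu[of "n - 1"] i by (simp add: T_def)
  qed
  have DMu: "D $$ (j, j) * (\<Sum>k<n. M $$ (k, j) * u $ k) = 0" if j: "j < n" for j
  proof (cases "Suc j < n")
    case True
    then have "D $$ (j, j) * (\<Sum>k<n. M $$ (k, j) * u $ k) = (\<Sum>k<n. T $$ (j, k) * u $ k)"
      by (auto simp: sum_distrib_left T_def intro!: sum.cong)
    then show ?thesis
      using Tu[OF j] by simp
  next
    case False
    then have "j = n - 1"
      using j by simp
    \<comment> \<open>In the last row of \<open>M^T\<close> only the diagonal entry survives, and it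
      meets the last entry of \<open>u\<close>, which is 0.\<close>
    then have "(\<Sum>k<n. M $$ (k, j) * u $ k) = M $$ (j, j) * u $ j"
      using M0 j by (intro sum_mult_eq_single) auto
    then show ?thesis
      using last \<open>j = n - 1\<close> by simp
  qed
  define x where "x = vec n (\<lambda>j. u $ p j)"
  have x: "x \<in> carrier_vec n"
    by (simp add: x_def)
  have "factored P M D *\<^sub>v x = 0\<^sub>v n"
  proof (rule eq_vecI)
    fix j assume j: "j < dim_vec (0\<^sub>v n :: real vec)"
    have "(factored P M D *\<^sub>v x) $ j
        = (\<Sum>l<n. M $$ (p j, l) * (D $$ (l, l) * (\<Sum>k<n. M $$ (k, l) * u $ k)))"
      using j by (intro factored_mult_vec[OF p P M(1) D x]) (auto simp: x_def)
    then show "(factored P M D *\<^sub>v x) $ j = 0\<^sub>v n $ j"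
      using DMu j by simp
  qed (use P in \<open>simp add: factored_def\<close>)
  then obtain c where c: "x = c \<cdot>\<^sub>v all_ones n"
    using Z x by (auto simp: kernel_is_constants_def)
  have uc: "u $ k = c" if k: "k < n" for k
  proof -
    obtain j where "j < n" "p j = k"
      using k permutes_image[OF p] by (metis imageE lessThan_iff)
    then show ?thesis
      using arg_cong[OF c, of "\<lambda>x. x $ j"] by (simp add: x_def all_ones_def)
  qed
  then have "c = 0"
    using last i by simp
  then have "u = 0\<^sub>v n"
    using uc u(1) by (intro eq_vecI) auto
  then show False
    using u by simp
qed

text \<open>
  The last pivot of a singular factorization vanishes, so only the first \<open>n - 1\<close> equations of
  each triangular system are imposed; the remaining one follows because the components of both
  sides sum to \<open>0\<close>.
\<close>

lemma factored_solve:
  fixes M D :: "real mat" and y w v :: "nat \<Rightarrow> real"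
  assumes p: "p permutes {..<n}" and P: "P = mat n n (\<lambda>(i, j). if j = p i then 1 else 0)"
    and M: "M \<in> carrier_mat n n" "lower_triangular M" and D: "D \<in> carrier_mat n n" "diagonal_mat D"
    and Z: "kernel_is_constants n (factored P M D)"
    and y: "(\<Sum>i<n. y i) = 0"
    and fw: "\<And>i. Suc i < n \<Longrightarrow> (\<Sum>j<n. M $$ (i, j) * w j) = y i"
    and bw: "\<And>j. Suc j < n \<Longrightarrow> D $$ (j, j) * (\<Sum>k<n. M $$ (k, j) * v k) = w j"
  shows "pinv (factored P M D) *\<^sub>v vec n (\<lambda>i. y (p i)) = vec n (\<lambda>i. v (p i) - (\<Sum>k<n. v k) / real n)"
proof -
  let ?Z = "factored P M D"
  have n: "0 < n" and Zc: "?Z \<in> carrier_mat n n" and Zs: "?Z\<^sup>T = ?Z"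
    using Z by (auto simp: kernel_is_constants_def)
  have Z1: "?Z *\<^sub>v all_ones n = 0\<^sub>v n"
    using Z unfolding kernel_is_constants_def by (metis all_ones_carrier one_smult_vec)
  have pn: "p j < n" if "j < n" for j
    using permutes_in_image[OF p, of j] that by simp
  define x where "x = vec n (\<lambda>i. v (p i))"
  have x: "x \<in> carrier_vec n"
    by (simp add: x_def)
  define N where "N i = (\<Sum>j<n. M $$ (i, j) * (D $$ (j, j) * (\<Sum>k<n. M $$ (k, j) * v k)))" for i
  have Zx: "(?Z *\<^sub>v x) $ i = N (p i)" if "i < n" for i
    unfolding N_def using that by (intro factored_mult_vec[OF p P M(1) D x]) (auto simp: x_def)
  have sum_p: "(\<Sum>i<n. f (p i)) = (\<Sum>i<n. f i)" for f :: "nat \<Rightarrow> real"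
    using sum.permute[OF p, of f] by (simp add: o_def)
  have Ny: "N i = y i" if i: "Suc i < n" for i
  proof -
    \<comment> \<open>No relation between \<open>v\<close> and \<open>w\<close> is assumed at
      \<open>j = n - 1\<close>, but there the coefficient vanishes, since row \<open>i\<close> ends
      before the last column.\<close>
    have "M $$ (i, j) * (D $$ (j, j) * (\<Sum>k<n. M $$ (k, j) * v k)) = M $$ (i, j) * w j"
      if j: "j < n" for j
    proof (cases "Suc j < n")
      case False
      then have "M $$ (i, j) = 0"
        using M i j by (auto simp: lower_triangular_def)
      then show ?thesis
        by simp
    qed (simp add: bw)
    then have "N i = (\<Sum>j<n. M $$ (i, j) * w j)"
      unfolding N_def by (intro sum.cong) auto
    then show ?thesis
      using fw[OF i] by simp
  qed
  have "(\<Sum>i<n. N i) = all_ones n \<bullet> (?Z *\<^sub>v x)"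
    using Zc x Zx by (subst all_ones_scalar_prod) (auto simp flip: sum_p[of N])
  also have "\<dots> = 0"
    using symmetric_form_commute[OF Zc Zs all_ones_carrier x] x by (simp add: Z1)
  finally have N0: "(\<Sum>i<n. N i) = 0" .
  obtain k where k: "n = Suc k"
    using n by (cases n) auto
  have "(\<Sum>i<k. N i) = (\<Sum>i<k. y i)"
    using Ny by (intro sum.cong) (auto simp: k)
  then have "N k = y k"
    using N0 y by (simp add: k)
  then have Ny': "N i = y i" if "i < n" for i
    using Ny that k by (cases "i = k") auto
  have Zy: "?Z *\<^sub>v x = vec n (\<lambda>i. y (p i))"
    using Zc Zx Ny' pn by (intro eq_vecI) (auto simp del: index_mult_mat_vec)
  let ?m = "(\<Sum>k<n. v k) / real n"
  have vx: "vec n (\<lambda>i. v (p i) - ?m) = x - ?m \<cdot>\<^sub>v all_ones n"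
    by (intro eq_vecI) (auto simp: x_def all_ones_def)
  show ?thesis
  proof (rule pinv_mult_vec_eqI[OF Z])
    show "vec n (\<lambda>i. v (p i) - ?m) \<in> carrier_vec n"
      by simp
    show "all_ones n \<bullet> vec n (\<lambda>i. v (p i) - ?m) = 0"
      using n by (subst all_ones_scalar_prod) (auto simp: sum_subtractf sum_p[of v])
    show "all_ones n \<bullet> vec n (\<lambda>i. y (p i)) = 0"
      by (subst all_ones_scalar_prod) (auto simp: sum_p[of y] y)
    have "?Z *\<^sub>v (?m \<cdot>\<^sub>v all_ones n) = 0\<^sub>v n"
      using Zc Z1 by (auto simp: mult_mat_vec[of _ n n])
    then show "?Z *\<^sub>v vec n (\<lambda>i. v (p i) - ?m) = vec n (\<lambda>i. y (p i))"
      unfolding vx using Zc x Zy by (simp add: mult_minus_distrib_mat_vec[of _ n n])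
  qed
qed

section \<open>Bounded executions\<close>

text \<open>Syntactic over-approximations of what a command changes. They give every execution a
  frame, so that loop invariants speak only of arrays that the loop modifies.\<close>

fun nat_writes :: "com \<Rightarrow> name set" where
  "nat_writes Skip = {}"
| "nat_writes (NPut a i e) = {a}"
| "nat_writes (RPut a i e) = {}"
| "nat_writes (Seq c d) = nat_writes c \<union> nat_writes d"
| "nat_writes (Cond b c d) = nat_writes c \<union> nat_writes d"
| "nat_writes (Loop b c) = nat_writes c"

fun real_writes :: "com \<Rightarrow> name set" where
  "real_writes Skip = {}"
| "real_writes (NPut a i e) = {}"
| "real_writes (RPut a i e) = {a}"
| "real_writes (Seq c d) = real_writes c \<union> real_writes d"
| "real_writes (Cond b c d) = real_writes c \<union> real_writes d"
| "real_writes (Loop b c) = real_writes c"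

definition agree_outside :: "name set \<Rightarrow> name set \<Rightarrow> state \<Rightarrow> state \<Rightarrow> bool" where
  "agree_outside N R s s' \<longleftrightarrow>
     (\<forall>a. a \<notin> N \<longrightarrow> nats s' a = nats s a) \<and> (\<forall>a. a \<notin> R \<longrightarrow> reals s' a = reals s a)"

lemma agree_outside_refl [simp]: "agree_outside N R s s"
  by (simp add: agree_outside_def)

lemma agree_outside_trans:
  "agree_outside N R s s' \<Longrightarrow> agree_outside N' R' s' s'' \<Longrightarrow> N \<subseteq> K \<Longrightarrow> N' \<subseteq> K \<Longrightarrow> R \<subseteq> Q \<Longrightarrow> R' \<subseteq> Q \<Longrightarrow>
    agree_outside K Q s s''"
  unfolding agree_outside_def by (metis subsetD)

lemma agree_outside_mono:
  "agree_outside N R s s' \<Longrightarrow> N \<subseteq> K \<Longrightarrow> R \<subseteq> Q \<Longrightarrow> agree_outside K Q s s'"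
  unfolding agree_outside_def by blast

lemma exec_agree_outside: "exec c s T s' \<Longrightarrow> agree_outside (nat_writes c) (real_writes c) s s'"
proof (induction rule: exec.induct)
  case (Seq c s T s' d T' s'')
  then show ?case
    by (auto intro: agree_outside_trans)
next
  case (LoopTrue b s c T s' T' s'')
  then show ?case
    by (auto intro: agree_outside_trans)
qed (auto simp: agree_outside_def put_def)

text \<open>A triple for a single start state that joins termination, a step bound and a
  postcondition. While \<open>exec\<close> counts exactly, \<open>B\<close> is only an upper bound,
  so the costs of parts combine by inequalities.\<close>

definition runs :: "com \<Rightarrow> state \<Rightarrow> nat \<Rightarrow> (state \<Rightarrow> bool) \<Rightarrow> bool" where
  "runs c s B Q \<longleftrightarrow> (\<exists>T s'. exec c s T s' \<and> T \<le> B \<and> Q s')"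

text \<open>The consequence rule doubles as the frame rule: the new postcondition may use that
  arrays outside the write sets are unchanged.\<close>

lemma runs_weaken:
  assumes "runs c s B Q" "B \<le> B'"
    and "\<And>s'. agree_outside (nat_writes c) (real_writes c) s s' \<Longrightarrow> Q s' \<Longrightarrow> Q' s'"
  shows "runs c s B' Q'"
  using assms unfolding runs_def by (meson exec_agree_outside le_trans)

lemma runs_NPut:
  "Q (s\<lparr>nats := put (nats s) a (nval i s) (nval e s)\<rparr>) \<Longrightarrow> 1 \<le> B \<Longrightarrow> runs (NPut a i e) s B Q"
  unfolding runs_def by (blast intro: exec.NPut)

lemma runs_RPut:
  "Q (s\<lparr>reals := put (reals s) a (nval i s) (rval e s)\<rparr>) \<Longrightarrow> 1 \<le> B \<Longrightarrow> runs (RPut a i e) s B Q"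
  unfolding runs_def by (blast intro: exec.RPut)

lemma runs_Seq:
  assumes "runs c s A Q"
    and "\<And>s'. agree_outside (nat_writes c) (real_writes c) s s' \<Longrightarrow> Q s' \<Longrightarrow> runs d s' B R"
    and "A + B \<le> C"
  shows "runs (Seq c d) s C R"
proof -
  obtain T s' where c: "exec c s T s'" "T \<le> A" "Q s'"
    using assms(1) by (auto simp: runs_def)
  with assms(2)[OF exec_agree_outside[OF c(1)]] obtain T' s'' where d: "exec d s' T' s''" "T' \<le> B" "R s''"
    by (auto simp: runs_def)
  from exec.Seq[OF c(1) d(1)] show ?thesis
    using c d assms(3) unfolding runs_def by (metis add_mono le_trans)
qed

text \<open>\<open>I t\<close> describes the state after \<open>t\<close> rounds. A round pays for
  its body and a successful test; the leading 1 is the final failing test. The frame is always taken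
  from the start state \<open>s\<close>, so it does not have to be part of \<open>I\<close>.\<close>

lemma runs_Loop:
  fixes I :: "nat \<Rightarrow> state \<Rightarrow> bool"
  assumes "I 0 s"
    and guard: "\<And>t s'. t \<le> N \<Longrightarrow> I t s' \<Longrightarrow> agree_outside (nat_writes c) (real_writes c) s s' \<Longrightarrow> bval b s' \<longleftrightarrow> t < N"
    and body: "\<And>t s'. t < N \<Longrightarrow> I t s' \<Longrightarrow> agree_outside (nat_writes c) (real_writes c) s s' \<Longrightarrow> runs c s' (f t) (I (Suc t))"
  shows "runs (Loop b c) s (1 + (\<Sum>t<N. f t + 1)) (I N)"
proof -
  have "runs (Loop b c) s' (1 + (\<Sum>t=k..<N. f t + 1)) (I N)"
    if "k \<le> N" "I k s'" "agree_outside (nat_writes c) (real_writes c) s s'" for k s'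
    using that
  proof (induction "N - k" arbitrary: k s')
    case 0
    then have k: "k = N"
      by simp
    then have "exec (Loop b c) s' 1 s'"
      using 0 guard[of k s'] by (intro exec.LoopFalse) simp
    then show ?case
      using 0 k unfolding runs_def by (intro exI[of _ 1] exI[of _ s']) simp
  next
    case (Suc d)
    then have k: "k < N"
      by simp
    obtain T s1 where c: "exec c s' T s1" "T \<le> f k" "I (Suc k) s1"
      using body[OF k Suc.prems(2,3)] by (auto simp: runs_def)
    have ag: "agree_outside (nat_writes c) (real_writes c) s s1"
      using agree_outside_trans[OF Suc.prems(3) exec_agree_outside[OF c(1)]] by simp
    obtain U s2 where l: "exec (Loop b c) s1 U s2" "U \<le> 1 + (\<Sum>t=Suc k..<N. f t + 1)" "I N s2"
      using Suc.hyps(1)[of "Suc k" s1] Suc.hyps(2) k c(3) ag unfolding runs_def by (metis Suc_leI diff_Suc_eq_diff_pred Suc_diff_Suc nat.inject)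
    have "exec (Loop b c) s' (1 + T + U) s2"
      using guard[OF Suc.prems] k c l by (intro exec.LoopTrue) auto
    moreover have "1 + T + U \<le> 1 + (\<Sum>t=k..<N. f t + 1)"
      using c l k by (simp add: sum.atLeast_Suc_lessThan)
    ultimately show ?case
      using l unfolding runs_def by blast
  qed
  from this[of 0 s] show ?thesis
    using assms(1) by (simp add: lessThan_atLeast0)
qed

section \<open>Counted loops\<close>

definition cell :: "name \<Rightarrow> nexp" where
  "cell a = NGet a (NConst 0)"

lemma nval_cell [simp]: "nval (cell a) s = nats s a 0"
  by (simp add: cell_def)

definition count_loop :: "name \<Rightarrow> nexp \<Rightarrow> nexp \<Rightarrow> com \<Rightarrow> com" where
  "count_loop i lo hi c = Seq (NPut i (NConst 0) lo)
     (Loop (NLess (cell i) hi) (Seq c (NPut i (NConst 0) (NAdd (cell i) (NConst 1)))))"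

lemma writes_count_loop [simp]:
  "nat_writes (count_loop i lo hi c) = insert i (nat_writes c)"
  "real_writes (count_loop i lo hi c) = real_writes c"
  by (auto simp: count_loop_def)

text \<open>The leading 2 pays for the initial assignment and the failing test, the 2 in each round
  for a test and the increment. The invariant sees only the real arrays, and the counter reaches the
  body separately; \<open>nval lo s \<le> N\<close> makes an empty range stop at
  \<open>N\<close>.\<close>

lemma runs_count_loop:
  fixes I :: "nat \<Rightarrow> (name \<Rightarrow> nat \<Rightarrow> real) \<Rightarrow> bool"
  assumes i: "i \<notin> nat_writes c"
    and lo: "nval lo s \<le> N"
    and hi: "\<And>s'. agree_outside (insert i (nat_writes c)) (real_writes c) s s' \<Longrightarrow> nval hi s' = N"
    and init: "I (nval lo s) (reals s)"
    and body: "\<And>k s'. nval lo s \<le> k \<Longrightarrow> k < N \<Longrightarrow> I k (reals s') \<Longrightarrow> nats s' i 0 = k \<Longrightarrow>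
      agree_outside (insert i (nat_writes c)) (real_writes c) s s' \<Longrightarrow> runs c s' (f k) (\<lambda>s''. I (Suc k) (reals s''))"
    and B: "2 + (\<Sum>k=nval lo s..<N. f k + 2) \<le> B"
  shows "runs (count_loop i lo hi c) s B (\<lambda>s'. I N (reals s'))"
proof -
  let ?l = "nval lo s"
  let ?s0 = "s\<lparr>nats := put (nats s) i 0 ?l\<rparr>"
  let ?c = "Seq c (NPut i (NConst 0) (NAdd (cell i) (NConst 1)))"
  define J where "J t s' \<longleftrightarrow> I (?l + t) (reals s') \<and> nats s' i 0 = ?l + t" for t and s' :: state
  have ag0: "agree_outside (insert i (nat_writes c)) (real_writes c) s ?s0"
    by (auto simp: agree_outside_def put_def)
  have ag: "agree_outside (insert i (nat_writes c)) (real_writes c) s s'"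
    if "agree_outside (nat_writes ?c) (real_writes ?c) ?s0 s'" for s'
    by (rule agree_outside_trans[OF ag0 that]) auto
  have loop: "runs (Loop (NLess (cell i) hi) ?c) ?s0 (1 + (\<Sum>t<N - ?l. (f (?l + t) + 1) + 1)) (J (N - ?l))"
  proof (rule runs_Loop)
    show "J 0 ?s0"
      using init by (simp add: J_def put_def)
    show "bval (NLess (cell i) hi) s' \<longleftrightarrow> t < N - ?l"
      if "J t s'" "agree_outside (nat_writes ?c) (real_writes ?c) ?s0 s'" for t s'
      using that hi[OF ag[OF that(2)]] by (auto simp: J_def)
    show "runs ?c s' (f (?l + t) + 1) (J (Suc t))"
      if t: "t < N - ?l" "J t s'" "agree_outside (nat_writes ?c) (real_writes ?c) ?s0 s'" for t s'
    proof (rule runs_Seq)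
      show "runs c s' (f (?l + t)) (\<lambda>s''. I (Suc (?l + t)) (reals s''))"
        using t ag[OF t(3)] by (intro body) (auto simp: J_def)
      show "runs (NPut i (NConst 0) (NAdd (cell i) (NConst 1))) s'' 1 (J (Suc t))"
        if "agree_outside (nat_writes c) (real_writes c) s' s''" "I (Suc (?l + t)) (reals s'')" for s''
        using that t i by (intro runs_NPut) (auto simp: J_def put_def agree_outside_def)
    qed simp
  qed
  have "(\<Sum>t<N - ?l. (f (?l + t) + 1) + 1) = (\<Sum>k=?l..<N. f k + 2)"
    using sum.shift_bounds_nat_ivl[of "\<lambda>k. f k + 2" 0 ?l "N - ?l"] lo
    by (simp add: lessThan_atLeast0 add.commute)
  then have "1 + (1 + (\<Sum>t<N - ?l. (f (?l + t) + 1) + 1)) \<le> B"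
    using B by simp
  moreover have "runs (NPut i (NConst 0) lo) s 1 (\<lambda>s'. s' = ?s0)"
    by (intro runs_NPut) auto
  moreover have "runs (Loop (NLess (cell i) hi) ?c) ?s0 (1 + (\<Sum>t<N - ?l. (f (?l + t) + 1) + 1)) (\<lambda>s'. I N (reals s'))"
    using loop by (rule runs_weaken) (use lo in \<open>auto simp: J_def\<close>)
  ultimately show ?thesis
    unfolding count_loop_def by (auto intro: runs_Seq[where Q = "\<lambda>s'. s' = ?s0"])
qed

section \<open>Sparse rows\<close>

definition row_nnz :: "real mat \<Rightarrow> nat \<Rightarrow> nat" where
  "row_nnz A i = card {j. j < dim_col A \<and> A $$ (i, j) \<noteq> 0}"

lemma sum_row_nnz: "(\<Sum>i<dim_row A. row_nnz A i) = nnz A"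
proof -
  have "{(i, j). i < dim_row A \<and> j < dim_col A \<and> A $$ (i, j) \<noteq> 0}
      = (SIGMA i:{..<dim_row A}. {j. j < dim_col A \<and> A $$ (i, j) \<noteq> 0})"
    by auto
  then show ?thesis
    by (simp add: nnz_def row_nnz_def)
qed

text \<open>Stored positions of a row correspond bijectively to its non-zero columns, and all other
  columns contribute 0; hence a loop over the storage computes a full row product.\<close>

lemma csr_row:
  assumes "csr A ptr cidx entry" "i < dim_row A"
  shows "ptr i \<le> ptr (Suc i)" "ptr (Suc i) - ptr i = row_nnz A i"
    and "(\<Sum>q=ptr i..<ptr (Suc i). entry q * f (cidx q)) = (\<Sum>j<dim_col A. A $$ (i, j) * f j)"
proof -
  have bij: "bij_betw cidx {ptr i..<ptr (Suc i)} {j. j < dim_col A \<and> A $$ (i, j) \<noteq> 0}"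
    and en: "\<And>q. q \<in> {ptr i..<ptr (Suc i)} \<Longrightarrow> entry q = A $$ (i, cidx q)"
    using assms by (auto simp: csr_def)
  show "ptr i \<le> ptr (Suc i)"
    using assms by (auto simp: csr_def)
  show "ptr (Suc i) - ptr i = row_nnz A i"
    using bij_betw_same_card[OF bij] by (simp add: row_nnz_def)
  have "(\<Sum>q=ptr i..<ptr (Suc i). entry q * f (cidx q))
      = (\<Sum>q=ptr i..<ptr (Suc i). A $$ (i, cidx q) * f (cidx q))"
    using en by (intro sum.cong) auto
  also have "\<dots> = (\<Sum>j | j < dim_col A \<and> A $$ (i, j) \<noteq> 0. A $$ (i, j) * f j)"
    using sum.reindex_bij_betw[OF bij, of "\<lambda>j. A $$ (i, j) * f j"] by simp
  also have "\<dots> = (\<Sum>j<dim_col A. A $$ (i, j) * f j)"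
    by (intro sum.mono_neutral_left) auto
  finally show "(\<Sum>q=ptr i..<ptr (Suc i). entry q * f (cidx q)) = (\<Sum>j<dim_col A. A $$ (i, j) * f j)" .
qed

definition row_loop :: "name \<Rightarrow> com \<Rightarrow> com" where
  "row_loop ptr c = count_loop ''k'' (NGet ptr (cell ''i'')) (NGet ptr (NAdd (cell ''i'') (NConst 1))) c"

definition row_dot :: "name \<Rightarrow> name \<Rightarrow> name \<Rightarrow> name \<Rightarrow> com" where
  "row_dot ptr cidx entry x = Seq (RPut ''a'' (NConst 0) (RConst 0))
     (row_loop ptr (RPut ''a'' (NConst 0)
       (RAdd (RGet ''a'' (NConst 0))
         (RMul (RGet entry (cell ''k'')) (RGet x (NGet cidx (cell ''k'')))))))"

text \<open>The column-oriented half of back substitution: as \<open>M\<close> is stored by rows,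
  the equations of \<open>M^T\<close> are reached by removing the contribution of a known
  \<open>v i\<close> from all of them along row \<open>i\<close>.\<close>

definition scatter_row :: "name \<Rightarrow> name \<Rightarrow> name \<Rightarrow> com" where
  "scatter_row ptr cidx entry = row_loop ptr (RPut ''u'' (NGet cidx (cell ''k''))
     (RSub (RGet ''u'' (NGet cidx (cell ''k'')))
       (RMul (RGet entry (cell ''k'')) (RGet ''v'' (cell ''i'')))))"

lemma writes_row_ops [simp]:
  "nat_writes (row_dot ptr cidx entry x) = {''k''}"
  "real_writes (row_dot ptr cidx entry x) = {''a''}"
  "nat_writes (scatter_row ptr cidx entry) = {''k''}"
  "real_writes (scatter_row ptr cidx entry) = {''u''}"
  by (auto simp: row_dot_def scatter_row_def row_loop_def)

lemma runs_row_dot: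
  assumes A: "csr A (nats s ptr) (nats s cidx) (reals s entry)" and i: "nats s ''i'' 0 < dim_row A"
    and ne: "ptr \<noteq> ''k''" "cidx \<noteq> ''k''" "entry \<noteq> ''a''" "x \<noteq> ''a''"
    and B: "3 + 3 * row_nnz A (nats s ''i'' 0) \<le> B"
  shows "runs (row_dot ptr cidx entry x) s B
    (\<lambda>s'. reals s' ''a'' 0 = (\<Sum>j<dim_col A. A $$ (nats s ''i'' 0, j) * reals s x j))"
proof -
  let ?i = "nats s ''i'' 0"
  let ?lo = "nats s ptr ?i" and ?hi = "nats s ptr (Suc ?i)"
  let ?s0 = "s\<lparr>reals := put (reals s) ''a'' 0 0\<rparr>"
  let ?c = "RPut ''a'' (NConst 0) (RAdd (RGet ''a'' (NConst 0))
         (RMul (RGet entry (cell ''k'')) (RGet x (NGet cidx (cell ''k'')))))"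
  note row = csr_row[OF A i]
  define I where "I k R \<longleftrightarrow> R ''a'' 0 = (\<Sum>q=?lo..<k. reals s entry q * reals s x (nats s cidx q))"
    for k and R :: "name \<Rightarrow> nat \<Rightarrow> real"
  have "runs (row_loop ptr ?c) ?s0 (2 + 3 * row_nnz A ?i) (\<lambda>s'. I ?hi (reals s'))"
    unfolding row_loop_def
  proof (rule runs_count_loop)
    show "''k'' \<notin> nat_writes ?c"
      by simp
    show "nval (NGet ptr (cell ''i'')) ?s0 \<le> ?hi"
      using row(1) by simp
    show "nval (NGet ptr (NAdd (cell ''i'') (NConst 1))) s' = ?hi"
      if "agree_outside (insert ''k'' (nat_writes ?c)) (real_writes ?c) ?s0 s'" for s'
      using that ne by (simp add: agree_outside_def)
    show "I (nval (NGet ptr (cell ''i'')) ?s0) (reals ?s0)"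
      by (simp add: I_def put_def)
    show "runs ?c s' 1 (\<lambda>s''. I (Suc k) (reals s''))"
      if "nval (NGet ptr (cell ''i'')) ?s0 \<le> k" "k < ?hi" "I k (reals s')" "nats s' ''k'' 0 = k"
        "agree_outside (insert ''k'' (nat_writes ?c)) (real_writes ?c) ?s0 s'" for k s'
      using that ne by (intro runs_RPut) (auto simp: I_def put_def agree_outside_def)
    show "2 + (\<Sum>k=nval (NGet ptr (cell ''i'')) ?s0..<?hi. 1 + 2) \<le> 2 + 3 * row_nnz A ?i"
      using row(2) by simp
  qed
  then have 1: "runs (row_loop ptr ?c) ?s0 (2 + 3 * row_nnz A ?i)
      (\<lambda>s'. reals s' ''a'' 0 = (\<Sum>j<dim_col A. A $$ (?i, j) * reals s x j))"
    by (simp add: I_def row(3))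
  show ?thesis
    unfolding row_dot_def
    by (rule runs_Seq[where Q = "\<lambda>s'. s' = ?s0" and A = 1]) (use 1 B in \<open>auto intro: runs_RPut\<close>)
qed

lemma runs_scatter_row:
  assumes A: "csr A (nats s ptr) (nats s cidx) (reals s entry)" and i: "nats s ''i'' 0 < dim_row A"
    and ne: "ptr \<noteq> ''k''" "cidx \<noteq> ''k''" "entry \<noteq> ''u''"
    and B: "2 + 3 * row_nnz A (nats s ''i'' 0) \<le> B"
  shows "runs (scatter_row ptr cidx entry) s B
    (\<lambda>s'. \<forall>j<dim_col A. reals s' ''u'' j = reals s ''u'' j - A $$ (nats s ''i'' 0, j) * reals s ''v'' (nats s ''i'' 0))"
proof -
  let ?i = "nats s ''i'' 0"
  let ?lo = "nats s ptr ?i" and ?hi = "nats s ptr (Suc ?i)"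
  let ?c = "RPut ''u'' (NGet cidx (cell ''k''))
     (RSub (RGet ''u'' (NGet cidx (cell ''k'')))
       (RMul (RGet entry (cell ''k'')) (RGet ''v'' (cell ''i''))))"
  note row = csr_row[OF A i]
  \<comment> \<open>A sum with an indicator describes every cell \<open>j\<close> at once, whatever
    the order of the columns; at the end the row product with that indicator extracts the entry in
    column \<open>j\<close>.\<close>
  define I where "I k R \<longleftrightarrow> (\<forall>j. R ''u'' j = reals s ''u'' j -
      (\<Sum>q=?lo..<k. reals s entry q * (if nats s cidx q = j then 1 else 0)) * reals s ''v'' ?i)"
    for k and R :: "name \<Rightarrow> nat \<Rightarrow> real"
  have "runs (row_loop ptr ?c) s (2 + 3 * row_nnz A ?i) (\<lambda>s'. I ?hi (reals s'))"
    unfolding row_loop_def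
  proof (rule runs_count_loop)
    show "''k'' \<notin> nat_writes ?c"
      by simp
    show "nval (NGet ptr (cell ''i'')) s \<le> ?hi"
      using row(1) by simp
    show "nval (NGet ptr (NAdd (cell ''i'') (NConst 1))) s' = ?hi"
      if "agree_outside (insert ''k'' (nat_writes ?c)) (real_writes ?c) s s'" for s'
      using that ne by (simp add: agree_outside_def)
    show "I (nval (NGet ptr (cell ''i'')) s) (reals s)"
      by (simp add: I_def)
    show "runs ?c s' 1 (\<lambda>s''. I (Suc k) (reals s''))"
      if "nval (NGet ptr (cell ''i'')) s \<le> k" "k < ?hi" "I k (reals s')" "nats s' ''k'' 0 = k"
        "agree_outside (insert ''k'' (nat_writes ?c)) (real_writes ?c) s s'" for k s'
      using that ne
      by (intro runs_RPut) (auto simp: I_def put_def agree_outside_def algebra_simps)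
    show "2 + (\<Sum>k=nval (NGet ptr (cell ''i'')) s..<?hi. 1 + 2) \<le> 2 + 3 * row_nnz A ?i"
      using row(2) by simp
  qed
  then show ?thesis
    unfolding scatter_row_def
  proof (rule runs_weaken)
    fix s' assume "I ?hi (reals s')"
    then have "reals s' ''u'' j = reals s ''u'' j - A $$ (?i, j) * reals s ''v'' ?i" if "j < dim_col A" for j
    proof -
      have "(\<Sum>q=?lo..<?hi. reals s entry q * (if nats s cidx q = j then 1 else 0)) = A $$ (?i, j) * 1"
        unfolding row(3)[of "\<lambda>l. if l = j then 1 else 0"]
        using sum_mult_eq_single[of "dim_col A" j "\<lambda>l. if l = j then 1 else 0 :: real" "\<lambda>l. A $$ (?i, l)"] that
        by (simp add: mult.commute)
      then show ?thesis
        using \<open>I ?hi (reals s')\<close> by (simp add: I_def)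
    qed
    then show "\<forall>j<dim_col A. reals s' ''u'' j = reals s ''u'' j - A $$ (?i, j) * reals s ''v'' ?i"
      by simp
  qed (use B in simp)
qed

section \<open>The solver\<close>

abbreviation "scalar a \<equiv> RGet a (NConst 0)"
abbreviation "row_index \<equiv> cell ''i''"

text \<open>The result goes to the permuted position \<open>P i\<close>, so that the triangular
  solves run in the coordinates of \<open>M\<close>.\<close>

definition residual_prog :: com where
  "residual_prog = count_loop ''i'' (NConst 0) (cell ''n'')
     (Seq (row_dot ''L_ptr'' ''L_col'' ''L_val'' ''x'')
       (RPut ''y'' (NGet ''P'' row_index) (RSub (scalar ''a'') (RGet ''b'' row_index))))"

text \<open>\<open>w i\<close> is zeroed before the row product because the stored row may contain
  its diagonal entry. The range stops before the last row, whose pivot may be 0.\<close>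

definition forward_prog :: com where
  "forward_prog = count_loop ''i'' (NConst 0) (NSub (cell ''n'') (NConst 1))
     (Seq (RPut ''w'' row_index (RConst 0))
     (Seq (row_dot ''M_ptr'' ''M_col'' ''M_val'' ''w'')
       (RPut ''w'' row_index (RDiv (RSub (RGet ''y'' row_index) (scalar ''a'')) (RGet ''g'' row_index)))))"

text \<open>The 0 put into \<open>v\<close> at the last index is the value chosen for the free
  unknown; elsewhere it marks unknowns not yet computed.\<close>

definition scale_prog :: com where
  "scale_prog = count_loop ''i'' (NConst 0) (cell ''n'')
     (Seq (RPut ''u'' row_index (RDiv (RGet ''w'' row_index) (RGet ''D'' row_index)))
       (RPut ''v'' row_index (RConst 0)))"

text \<open>The index is decremented before it is used, so the first unknown computed is the one at
  \<open>n - 2\<close> and the last the one at 0.\<close>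

definition backward_prog :: com where
  "backward_prog = Seq (NPut ''i'' (NConst 0) (NSub (cell ''n'') (NConst 1)))
     (Loop (NLess (NConst 0) row_index)
       (Seq (NPut ''i'' (NConst 0) (NSub row_index (NConst 1)))
       (Seq (RPut ''v'' row_index (RDiv (RGet ''u'' row_index) (RGet ''g'' row_index)))
         (scatter_row ''M_ptr'' ''M_col'' ''M_val''))))"

definition total_prog :: com where
  "total_prog = Seq (RPut ''s'' (NConst 0) (RConst 0))
     (count_loop ''i'' (NConst 0) (cell ''n'')
       (RPut ''s'' (NConst 0) (RAdd (scalar ''s'') (RGet ''v'' row_index))))"

text \<open>Reading \<open>v\<close> at \<open>P i\<close> undoes the permutation.
  \<open>s / r\<close> is the mean of \<open>v\<close>, and the division by 2 is the factor 1/2 of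
  the iteration, as constants are integers.\<close>

definition update_prog :: com where
  "update_prog = count_loop ''i'' (NConst 0) (cell ''n'')
     (RPut ''x'' row_index (RSub (RGet ''x'' row_index)
       (RDiv (RSub (RGet ''v'' (NGet ''P'' row_index)) (RDiv (scalar ''s'') (scalar ''r''))) (RConst 2))))"

definition step_prog :: com where
  "step_prog = Seq residual_prog (Seq forward_prog (Seq scale_prog (Seq backward_prog (Seq total_prog update_prog))))"

text \<open>\<open>r\<close> ends as the real number \<open>n\<close>, the divisor of the mean, and
  \<open>e\<close> as the zero vector from which the diagonal extraction starts.\<close>

definition clear_prog :: com where
  "clear_prog = Seq (RPut ''r'' (NConst 0) (RConst 0)) (count_loop ''i'' (NConst 0) (cell ''n'')
     (Seq (RPut ''x'' row_index (RConst 0))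
     (Seq (RPut ''e'' row_index (RConst 0))
       (RPut ''r'' (NConst 0) (RAdd (scalar ''r'') (RConst 1))))))"

text \<open>The diagonal entry of a row is its product with a unit vector, held in array \<open>e\<close>.\<close>

definition diagonal_prog :: com where
  "diagonal_prog = count_loop ''i'' (NConst 0) (cell ''n'')
     (Seq (RPut ''e'' row_index (RConst 1))
     (Seq (row_dot ''M_ptr'' ''M_col'' ''M_val'' ''e'')
     (Seq (RPut ''g'' row_index (scalar ''a''))
       (RPut ''e'' row_index (RConst 0)))))"

text \<open>The counter \<open>c\<close> is a real so that it can be compared with the logarithm;
  the strict test, starting from 0, yields the rounded-up number of rounds.\<close>

definition solver_prog :: com where
  "solver_prog = Seq clear_prog (Seq diagonal_prog (Seq (RPut ''c'' (NConst 0) (RConst 0))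
     (Loop (RLess (scalar ''c'') (RMul (RConst 3) (RLn (RDiv (RConst 1) (scalar ''eps'')))))
       (Seq step_prog (RPut ''c'' (NConst 0) (RAdd (scalar ''c'') (RConst 1)))))))"

section \<open>Frames and correctness of the passes\<close>

lemmas prog_defs = residual_prog_def forward_prog_def scale_prog_def backward_prog_def
  total_prog_def update_prog_def clear_prog_def diagonal_prog_def

lemma nat_writes_progs [simp]:
  "nat_writes residual_prog = {''i'', ''k''}" "nat_writes forward_prog = {''i'', ''k''}"
  "nat_writes scale_prog = {''i''}" "nat_writes backward_prog = {''i'', ''k''}"
  "nat_writes total_prog = {''i''}" "nat_writes update_prog = {''i''}"
  "nat_writes clear_prog = {''i''}" "nat_writes diagonal_prog = {''i'', ''k''}"
  by (auto simp: prog_defs)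

lemma real_writes_progs [simp]:
  "real_writes residual_prog = {''a'', ''y''}" "real_writes forward_prog = {''a'', ''w''}"
  "real_writes scale_prog = {''u'', ''v''}" "real_writes backward_prog = {''u'', ''v''}"
  "real_writes total_prog = {''s''}" "real_writes update_prog = {''x''}"
  "real_writes clear_prog = {''x'', ''e'', ''r''}" "real_writes diagonal_prog = {''e'', ''a'', ''g''}"
  by (auto simp: prog_defs)

lemma writes_step_prog [simp]:
  "nat_writes step_prog = {''i'', ''k''}"
  "real_writes step_prog = {''x'', ''a'', ''y'', ''w'', ''u'', ''v'', ''s''}"
  by (auto simp: step_prog_def)

definition work_reals :: "name set" where
  "work_reals = {''x'', ''a'', ''y'', ''e'', ''g'', ''w'', ''u'', ''v'', ''c'', ''s'', ''r''}"

text \<open>Scratch arrays and input arrays have disjoint names, so the description of the input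
  survives every pass.\<close>

lemma input_state_agree_outside:
  assumes "input_state n L P M D b \<epsilon> s" "agree_outside N R s s'" "N \<subseteq> {''i'', ''k''}" "R \<subseteq> work_reals"
  shows "input_state n L P M D b \<epsilon> s'"
proof -
  have ag: "agree_outside {''i'', ''k''} work_reals s s'"
    using assms(2-4) by (rule agree_outside_mono)
  then have "nats s' ''n'' = nats s ''n''" "nats s' ''L_ptr'' = nats s ''L_ptr''"
    "nats s' ''L_col'' = nats s ''L_col''" "nats s' ''P'' = nats s ''P''"
    "nats s' ''M_ptr'' = nats s ''M_ptr''" "nats s' ''M_col'' = nats s ''M_col''"
    "reals s' ''eps'' = reals s ''eps''" "reals s' ''b'' = reals s ''b''"
    "reals s' ''L_val'' = reals s ''L_val''" "reals s' ''M_val'' = reals s ''M_val''"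
    "reals s' ''D'' = reals s ''D''"
    by (simp_all add: agree_outside_def work_reals_def)
  then show ?thesis
    using assms(1) by (simp add: input_state_def)
qed

text \<open>The Loewner bounds enter the analysis of the program only through the kernel of the
  factored matrix. \<open>p\<close> is the permutation behind \<open>P\<close>, and the index array
  \<open>P\<close> of an input state has to agree with it below \<open>n\<close>.\<close>

locale factored_system =
  fixes n :: nat and L P M D :: "real mat" and b :: "real vec" and \<epsilon> :: real and p :: "nat \<Rightarrow> nat"
  assumes L: "kernel_is_constants n L"
    and p: "p permutes {..<n}" and P: "P = mat n n (\<lambda>(i, j). if j = p i then 1 else 0)"
    and M: "M \<in> carrier_mat n n" "lower_triangular M"
    and D: "D \<in> carrier_mat n n" "diagonal_mat D"
    and Z: "kernel_is_constants n (factored P M D)"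
    and b: "b \<in> carrier_vec n" "all_ones n \<bullet> b = 0"
begin

abbreviation input :: "state \<Rightarrow> bool" where
  "input s \<equiv> input_state n L P M D b \<epsilon> s"

lemma n_pos: "0 < n" and L_carrier: "L \<in> carrier_mat n n"
  using L by (auto simp: kernel_is_constants_def)

lemma p_eq_iff: "p i = p j \<longleftrightarrow> i = j"
  using permutes_inj[OF p] by (auto simp: inj_def)

lemma input_perm: "input s \<Longrightarrow> i < n \<Longrightarrow> nats s ''P'' i = p i"
  by (auto simp: input_state_def P split: if_splits)

lemma input_simps:
  assumes "input s"
  shows "nats s ''n'' 0 = n" "reals s ''eps'' 0 = \<epsilon>" "i < n \<Longrightarrow> reals s ''b'' i = b $ i"
    "i < n \<Longrightarrow> reals s ''D'' i = D $$ (i, i)"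
    "csr L (nats s ''L_ptr'') (nats s ''L_col'') (reals s ''L_val'')"
    "csr M (nats s ''M_ptr'') (nats s ''M_col'') (reals s ''M_val'')"
  using assms by (auto simp: input_state_def)

lemma sum_row_nnz_M: "(\<Sum>i=0..<n. row_nnz M i) = nnz M" and sum_row_nnz_L: "(\<Sum>i=0..<n. row_nnz L i) = nnz L"
  using sum_row_nnz[of M] sum_row_nnz[of L] M L_carrier by (auto simp: lessThan_atLeast0)

lemma M_upper: "i < j \<Longrightarrow> j < n \<Longrightarrow> M $$ (i, j) = 0"
  using M by (auto simp: lower_triangular_def)

lemma pivots: "Suc i < n \<Longrightarrow> M $$ (i, i) \<noteq> 0" "Suc i < n \<Longrightarrow> D $$ (i, i) \<noteq> 0"
  using factored_pivot_nonzero[OF p P M D Z, of i] by auto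

text \<open>\<open>p\<close> is injective, so writing \<open>y\<close> at \<open>p k\<close> leaves
  the entries of earlier rows intact.\<close>

lemma runs_residual:
  assumes "input s"
  shows "runs residual_prog s (2 + 6 * n + 3 * nnz L)
    (\<lambda>s'. \<forall>i<n. reals s' ''y'' (p i) = (\<Sum>j<n. L $$ (i, j) * reals s ''x'' j) - b $ i)"
proof -
  let ?c = "Seq (row_dot ''L_ptr'' ''L_col'' ''L_val'' ''x'')
       (RPut ''y'' (NGet ''P'' row_index) (RSub (scalar ''a'') (RGet ''b'' row_index)))"
  define I where "I k R \<longleftrightarrow> (\<forall>i<k. R ''y'' (p i) = (\<Sum>j<n. L $$ (i, j) * reals s ''x'' j) - b $ i)"
    for k and R :: "name \<Rightarrow> nat \<Rightarrow> real"
  have "runs residual_prog s (2 + 6 * n + 3 * nnz L) (\<lambda>s'. I n (reals s'))"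
    unfolding residual_prog_def
  proof (rule runs_count_loop)
    show "''i'' \<notin> nat_writes ?c"
      by simp
    show "nval (cell ''n'') s' = n"
      if "agree_outside (insert ''i'' (nat_writes ?c)) (real_writes ?c) s s'" for s'
      using that input_simps(1)[OF assms] by (simp add: agree_outside_def)
    fix k s'
    assume k: "nval (NConst 0) s \<le> k" "k < n" and I: "I k (reals s')" and i: "nats s' ''i'' 0 = k"
      and ag: "agree_outside (insert ''i'' (nat_writes ?c)) (real_writes ?c) s s'"
    have inp: "input s'"
      using input_state_agree_outside[OF assms ag] by (simp add: work_reals_def)
    have x: "reals s' ''x'' = reals s ''x''"
      using ag by (simp add: agree_outside_def)
    show "runs ?c s' (4 + 3 * row_nnz L k) (\<lambda>s''. I (Suc k) (reals s''))"
    proof (rule runs_Seq)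
      show "runs (row_dot ''L_ptr'' ''L_col'' ''L_val'' ''x'') s' (3 + 3 * row_nnz L k)
        (\<lambda>s'. reals s' ''a'' 0 = (\<Sum>j<n. L $$ (k, j) * reals s ''x'' j))"
        using runs_row_dot[OF input_simps(5)[OF inp], of "''x''"] L_carrier k i x by simp
      fix s'' assume ag': "agree_outside (nat_writes (row_dot ''L_ptr'' ''L_col'' ''L_val'' ''x''))
          (real_writes (row_dot ''L_ptr'' ''L_col'' ''L_val'' ''x'')) s' s''"
        and a: "reals s'' ''a'' 0 = (\<Sum>j<n. L $$ (k, j) * reals s ''x'' j)"
      have inp': "input s''"
        using input_state_agree_outside[OF inp ag'] by (simp add: work_reals_def)
      have "nats s'' ''i'' 0 = k" "reals s'' ''y'' = reals s' ''y''"
        using ag' i by (simp_all add: agree_outside_def)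
      then show "runs (RPut ''y'' (NGet ''P'' row_index) (RSub (scalar ''a'') (RGet ''b'' row_index))) s'' 1
          (\<lambda>s''. I (Suc k) (reals s''))"
        using I a k input_perm[OF inp'] input_simps(3)[OF inp']
        by (intro runs_RPut) (auto simp: I_def put_def p_eq_iff less_Suc_eq)
    qed simp
  next
    show "2 + (\<Sum>k=nval (NConst 0) s..<n. 4 + 3 * row_nnz L k + 2) \<le> 2 + 6 * n + 3 * nnz L"
      using sum_row_nnz_L by (simp add: sum.distrib flip: sum_distrib_left)
  qed (auto simp: I_def)
  then show ?thesis
    by (simp add: I_def)
qed

text \<open>Each round sets one cell of \<open>e\<close> and resets it, so that \<open>e\<close> is
  a unit vector during the row product at constant extra cost per row.\<close>

lemma runs_diagonal:
  assumes "input s" and e: "\<forall>i<n. reals s ''e'' i = 0"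
  shows "runs diagonal_prog s (2 + 8 * n + 3 * nnz M) (\<lambda>s'. \<forall>i<n. reals s' ''g'' i = M $$ (i, i))"
proof -
  let ?d = "row_dot ''M_ptr'' ''M_col'' ''M_val'' ''e''"
  let ?p1 = "RPut ''e'' row_index (RConst 1)" and ?p2 = "RPut ''g'' row_index (scalar ''a'')"
    and ?p3 = "RPut ''e'' row_index (RConst 0)"
  let ?c = "Seq ?p1 (Seq ?d (Seq ?p2 ?p3))"
  define I where "I k R \<longleftrightarrow> (\<forall>i<n. R ''e'' i = 0) \<and> (\<forall>i<k. R ''g'' i = M $$ (i, i))"
    for k and R :: "name \<Rightarrow> nat \<Rightarrow> real"
  have "runs diagonal_prog s (2 + 8 * n + 3 * nnz M) (\<lambda>s'. I n (reals s'))"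
    unfolding diagonal_prog_def
  proof (rule runs_count_loop)
    show "''i'' \<notin> nat_writes ?c"
      by simp
    show "nval (cell ''n'') s' = n"
      if "agree_outside (insert ''i'' (nat_writes ?c)) (real_writes ?c) s s'" for s'
      using that input_simps(1)[OF assms(1)] by (simp add: agree_outside_def)
    fix k s'
    assume k: "nval (NConst 0) s \<le> k" "k < n" and I: "I k (reals s')" and i: "nats s' ''i'' 0 = k"
      and ag: "agree_outside (insert ''i'' (nat_writes ?c)) (real_writes ?c) s s'"
    have inp: "input s'"
      using input_state_agree_outside[OF assms(1) ag] by (simp add: work_reals_def)
    define s1 where "s1 = s'\<lparr>reals := put (reals s') ''e'' k 1\<rparr>"
    have s1: "input s1" "nats s1 ''i'' 0 = k"
      using inp i by (auto simp: s1_def input_state_def put_def)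
    have e1: "(\<Sum>j<n. M $$ (k, j) * reals s1 ''e'' j) = M $$ (k, k)"
      using I k sum_mult_eq_single[of n k "reals s1 ''e''" "\<lambda>j. M $$ (k, j)"]
      by (simp add: s1_def I_def put_def mult.commute)
    show "runs ?c s' (6 + 3 * row_nnz M k) (\<lambda>s''. I (Suc k) (reals s''))"
    proof (rule runs_Seq)
      show "runs ?p1 s' 1 (\<lambda>s. s = s1)"
        using i by (intro runs_RPut) (auto simp: s1_def)
      fix t assume "t = s1"
      show "runs (Seq ?d (Seq ?p2 ?p3)) t (5 + 3 * row_nnz M k) (\<lambda>s''. I (Suc k) (reals s''))"
        unfolding \<open>t = s1\<close>
      proof (rule runs_Seq)
        show "runs ?d s1 (3 + 3 * row_nnz M k) (\<lambda>s'. reals s' ''a'' 0 = M $$ (k, k))"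
          using runs_row_dot[OF input_simps(6)[OF s1(1)], of "''e''"] M k s1 e1 by simp
        fix s2 assume ag2: "agree_outside (nat_writes ?d) (real_writes ?d) s1 s2"
          and a: "reals s2 ''a'' 0 = M $$ (k, k)"
        have i2: "nats s2 ''i'' 0 = k" and R: "reals s2 ''e'' = (reals s' ''e'')(k := 1)" "reals s2 ''g'' = reals s' ''g''"
          using ag2 s1 by (simp_all add: agree_outside_def s1_def put_def)
        define s3 where "s3 = s2\<lparr>reals := put (reals s2) ''g'' k (M $$ (k, k))\<rparr>"
        show "runs (Seq ?p2 ?p3) s2 2 (\<lambda>s''. I (Suc k) (reals s''))"
        proof (rule runs_Seq)
          show "runs ?p2 s2 1 (\<lambda>s. s = s3)"
            using i2 a by (intro runs_RPut) (auto simp: s3_def)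
          show "runs ?p3 t 1 (\<lambda>s''. I (Suc k) (reals s''))" if "t = s3" for t
            using that I i2 k R by (intro runs_RPut) (auto simp: I_def put_def s3_def less_Suc_eq)
        qed simp
      qed simp
    qed simp
  next
    show "2 + (\<Sum>k=nval (NConst 0) s..<n. 6 + 3 * row_nnz M k + 2) \<le> 2 + 8 * n + 3 * nnz M"
      using sum_row_nnz_M by (simp add: sum.distrib flip: sum_distrib_left)
  qed (use e in \<open>auto simp: I_def\<close>)
  then show ?thesis
    by (rule runs_weaken) (auto simp: I_def)
qed

text \<open>A later unknown has coefficient 0 in earlier equations, as \<open>M\<close> is lower
  triangular, so solved equations stay solved. For the same reason arbitrary contents of
  \<open>w\<close> beyond \<open>k\<close> do not disturb the row product.\<close>

lemma runs_forward:
  assumes "input s" and g: "\<forall>i<n. reals s ''g'' i = M $$ (i, i)"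
  shows "runs forward_prog s (2 + 7 * n + 3 * nnz M)
    (\<lambda>s'. \<forall>i. Suc i < n \<longrightarrow> (\<Sum>j<n. M $$ (i, j) * reals s' ''w'' j) = reals s ''y'' i)"
proof -
  let ?d = "row_dot ''M_ptr'' ''M_col'' ''M_val'' ''w''"
  let ?p1 = "RPut ''w'' row_index (RConst 0)"
    and ?p2 = "RPut ''w'' row_index (RDiv (RSub (RGet ''y'' row_index) (scalar ''a'')) (RGet ''g'' row_index))"
  let ?c = "Seq ?p1 (Seq ?d ?p2)"
  define I where "I k R \<longleftrightarrow> (\<forall>i<k. (\<Sum>j<n. M $$ (i, j) * R ''w'' j) = reals s ''y'' i)"
    for k and R :: "name \<Rightarrow> nat \<Rightarrow> real"
  have "runs forward_prog s (2 + 7 * n + 3 * nnz M) (\<lambda>s'. I (n - 1) (reals s'))"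
    unfolding forward_prog_def
  proof (rule runs_count_loop)
    show "''i'' \<notin> nat_writes ?c"
      by simp
    show "nval (NSub (cell ''n'') (NConst 1)) s' = n - 1"
      if "agree_outside (insert ''i'' (nat_writes ?c)) (real_writes ?c) s s'" for s'
      using that input_simps(1)[OF assms(1)] by (simp add: agree_outside_def)
    fix k s'
    assume k0: "nval (NConst 0) s \<le> k" "k < n - 1" and I: "I k (reals s')" and i: "nats s' ''i'' 0 = k"
      and ag: "agree_outside (insert ''i'' (nat_writes ?c)) (real_writes ?c) s s'"
    have k: "k < n" "Suc k < n"
      using k0 by auto
    have inp: "input s'"
      using input_state_agree_outside[OF assms(1) ag] by (simp add: work_reals_def)
    have R0: "reals s' ''y'' = reals s ''y''" "reals s' ''g'' = reals s ''g''"
      using ag by (simp_all add: agree_outside_def)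
    define s1 where "s1 = s'\<lparr>reals := put (reals s') ''w'' k 0\<rparr>"
    have s1: "input s1" "nats s1 ''i'' 0 = k"
      using inp i by (auto simp: s1_def input_state_def put_def)
    define a where "a = (\<Sum>j<n. M $$ (k, j) * reals s1 ''w'' j)"
    show "runs ?c s' (5 + 3 * row_nnz M k) (\<lambda>s''. I (Suc k) (reals s''))"
    proof (rule runs_Seq)
      show "runs ?p1 s' 1 (\<lambda>s. s = s1)"
        using i by (intro runs_RPut) (auto simp: s1_def)
      fix t assume "t = s1"
      show "runs (Seq ?d ?p2) t (4 + 3 * row_nnz M k) (\<lambda>s''. I (Suc k) (reals s''))"
        unfolding \<open>t = s1\<close>
      proof (rule runs_Seq)
        show "runs ?d s1 (3 + 3 * row_nnz M k) (\<lambda>s'. reals s' ''a'' 0 = a)"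
          using runs_row_dot[OF input_simps(6)[OF s1(1)], of "''w''"] M k s1 by (simp add: a_def)
        fix s2 assume ag2: "agree_outside (nat_writes ?d) (real_writes ?d) s1 s2"
          and a: "reals s2 ''a'' 0 = a"
        have w1: "reals s1 ''w'' = (reals s' ''w'')(k := 0)"
          by (simp add: s1_def put_def)
        define q where "q = (reals s ''y'' k - a) / M $$ (k, k)"
        have i2: "nats s2 ''i'' 0 = k" and R: "reals s2 ''w'' = (reals s' ''w'')(k := 0)"
          "reals s2 ''y'' = reals s ''y''" "reals s2 ''g'' = reals s ''g''"
          using ag2 s1 R0 by (simp_all add: agree_outside_def s1_def put_def)
        \<comment> \<open>Splits off the only changed cell: \<open>z = 0\<close> gives the row
          product that the machine computes, \<open>z = q\<close> the one to be established.\<close>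
        have upd: "(\<Sum>j<n. M $$ (i, j) * ((reals s' ''w'')(k := z)) j)
            = (\<Sum>j\<in>{..<n} - {k}. M $$ (i, j) * reals s' ''w'' j) + M $$ (i, k) * z" for i z
          using k by (simp add: sum.remove[of "{..<n}" k])
        have "(\<Sum>j<n. M $$ (i, j) * ((reals s' ''w'')(k := q)) j) = reals s ''y'' i" if "i < Suc k" for i
        proof (cases "i = k")
          case True
          have "a = (\<Sum>j\<in>{..<n} - {k}. M $$ (k, j) * reals s' ''w'' j)"
            using upd[of k 0] by (simp only: a_def w1)
          then show ?thesis
            unfolding True upd using pivots(1)[OF k(2)] by (simp add: q_def)
        next
          case False
          then have "(\<Sum>j<n. M $$ (i, j) * ((reals s' ''w'')(k := q)) j) = (\<Sum>j<n. M $$ (i, j) * reals s' ''w'' j)"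
            using M_upper[of i k] that k by (intro sum.cong) auto
          then show ?thesis
            using I that False by (simp add: I_def)
        qed
        then show "runs ?p2 s2 1 (\<lambda>s''. I (Suc k) (reals s''))"
          using i2 a g k R by (intro runs_RPut) (auto simp: I_def put_def q_def)
      qed simp
    qed simp
  next
    have "(\<Sum>k=0..<n - 1. row_nnz M k) \<le> (\<Sum>k=0..<n. row_nnz M k)"
      by (intro sum_mono2) auto
    then show "2 + (\<Sum>k=nval (NConst 0) s..<n - 1. 5 + 3 * row_nnz M k + 2) \<le> 2 + 7 * n + 3 * nnz M"
      using sum_row_nnz_M n_pos by (simp add: sum.distrib flip: sum_distrib_left)
  qed (auto simp: I_def)
  then show ?thesis
    by (rule runs_weaken) (auto simp: I_def)
qed

lemma runs_scale:
  assumes "input s"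
  shows "runs scale_prog s (2 + 4 * n)
    (\<lambda>s'. \<forall>i<n. reals s' ''u'' i = reals s ''w'' i / D $$ (i, i) \<and> reals s' ''v'' i = 0)"
proof -
  let ?p1 = "RPut ''u'' row_index (RDiv (RGet ''w'' row_index) (RGet ''D'' row_index))"
    and ?p2 = "RPut ''v'' row_index (RConst 0)"
  define I where "I k R \<longleftrightarrow> (\<forall>i<k. R ''u'' i = reals s ''w'' i / D $$ (i, i) \<and> R ''v'' i = 0)"
    for k and R :: "name \<Rightarrow> nat \<Rightarrow> real"
  have "runs scale_prog s (2 + 4 * n) (\<lambda>s'. I n (reals s'))"
    unfolding scale_prog_def
  proof (rule runs_count_loop)
    show "''i'' \<notin> nat_writes (Seq ?p1 ?p2)"
      by simp
    show "nval (cell ''n'') s' = n"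
      if "agree_outside (insert ''i'' (nat_writes (Seq ?p1 ?p2))) (real_writes (Seq ?p1 ?p2)) s s'" for s'
      using that input_simps(1)[OF assms] by (simp add: agree_outside_def)
    fix k s'
    assume k: "nval (NConst 0) s \<le> k" "k < n" and I: "I k (reals s')" and i: "nats s' ''i'' 0 = k"
      and ag: "agree_outside (insert ''i'' (nat_writes (Seq ?p1 ?p2))) (real_writes (Seq ?p1 ?p2)) s s'"
    have R: "reals s' ''w'' = reals s ''w''" "reals s' ''D'' = reals s ''D''"
      using ag by (simp_all add: agree_outside_def)
    define s1 where "s1 = s'\<lparr>reals := put (reals s') ''u'' k (reals s ''w'' k / D $$ (k, k))\<rparr>"
    show "runs (Seq ?p1 ?p2) s' 2 (\<lambda>s''. I (Suc k) (reals s''))"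
    proof (rule runs_Seq)
      show "runs ?p1 s' 1 (\<lambda>s. s = s1)"
        using i k R input_simps(4)[OF assms] by (intro runs_RPut) (auto simp: s1_def)
      show "runs ?p2 t 1 (\<lambda>s''. I (Suc k) (reals s''))" if "t = s1" for t
        using that I i by (intro runs_RPut) (auto simp: I_def put_def s1_def less_Suc_eq)
    qed simp
  qed (auto simp: I_def)
  then show ?thesis
    by (simp add: I_def)
qed

text \<open>Row \<open>i\<close> of \<open>M\<close> ends at column \<open>i\<close>, so fixing
  \<open>v i\<close> affects only equations up to \<open>i\<close>: equation \<open>i\<close>, which
  the division makes true, and the earlier ones, whose right-hand sides the scattered row
  corrects.\<close>

lemma runs_backward:
  assumes "input s" and g: "\<forall>i<n. reals s ''g'' i = M $$ (i, i)"
    and u: "\<forall>i<n. reals s ''u'' i = ud i \<and> reals s ''v'' i = 0"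
  shows "runs backward_prog s (2 + 5 * n + 3 * nnz M)
    (\<lambda>s'. \<forall>j. Suc j < n \<longrightarrow> (\<Sum>k<n. M $$ (k, j) * reals s' ''v'' k) = ud j)"
proof -
  let ?p1 = "NPut ''i'' (NConst 0) (NSub row_index (NConst 1))"
    and ?p2 = "RPut ''v'' row_index (RDiv (RGet ''u'' row_index) (RGet ''g'' row_index))"
    and ?sc = "scatter_row ''M_ptr'' ''M_col'' ''M_val''"
  let ?c = "Seq ?p1 (Seq ?p2 ?sc)"
  define s0 where "s0 = s\<lparr>nats := put (nats s) ''i'' 0 (n - 1)\<rparr>"
  have s0: "input s0" "reals s0 = reals s"
    using assms(1) by (auto simp: s0_def input_state_def put_def)
  \<comment> \<open>After \<open>t\<close> rounds the equations from \<open>n - 1 - t\<close> on are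
    solved; below that, \<open>u\<close> holds what is left of the right-hand side and
    \<open>v\<close> is still 0.\<close>
  define I :: "nat \<Rightarrow> state \<Rightarrow> bool" where "I t s' \<longleftrightarrow> nats s' ''i'' 0 = n - 1 - t \<and>
      (\<forall>j. n - 1 - t \<le> j \<longrightarrow> Suc j < n \<longrightarrow> (\<Sum>k<n. M $$ (k, j) * reals s' ''v'' k) = ud j) \<and>
      (\<forall>j<n - 1 - t. reals s' ''u'' j = ud j - (\<Sum>k<n. M $$ (k, j) * reals s' ''v'' k) \<and> reals s' ''v'' j = 0)"
    for t s'
  have "runs (Loop (NLess (NConst 0) row_index) ?c) s0
      (1 + (\<Sum>t<n - 1. (4 + 3 * row_nnz M (n - 1 - Suc t)) + 1)) (I (n - 1))"
  proof (rule runs_Loop)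
    show "I 0 s0"
      using u by (auto simp: I_def s0(2)) (auto simp: s0_def put_def)
    show "bval (NLess (NConst 0) row_index) s' \<longleftrightarrow> t < n - 1" if "I t s'" for t s'
      using that by (auto simp: I_def)
    fix t s' assume t: "t < n - 1" and I: "I t s'" and ag: "agree_outside (nat_writes ?c) (real_writes ?c) s0 s'"
    define i where "i = n - 1 - Suc t"
    have i: "i < n" "Suc i < n" "n - 1 - t = Suc i"
      using t by (auto simp: i_def)
    have inp: "input s'"
      using input_state_agree_outside[OF s0(1) ag] by (simp add: work_reals_def)
    have gi: "reals s' ''g'' i = M $$ (i, i)"
      using ag g i by (simp add: agree_outside_def s0(2))
    define s1 where "s1 = s'\<lparr>nats := put (nats s') ''i'' 0 i\<rparr>"
    define q where "q = reals s' ''u'' i / M $$ (i, i)"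
    define s2 where "s2 = s1\<lparr>reals := put (reals s') ''v'' i q\<rparr>"
    have s2: "input s2" "nats s2 ''i'' 0 = i" "reals s2 ''v'' = (reals s' ''v'')(i := q)" "reals s2 ''u'' = reals s' ''u''"
      using inp by (auto simp: s2_def s1_def input_state_def put_def)
    show "runs ?c s' (4 + 3 * row_nnz M (n - 1 - Suc t)) (I (Suc t))"
      unfolding i_def[symmetric]
    proof (rule runs_Seq)
      show "runs ?p1 s' 1 (\<lambda>s. s = s1)"
        using I i by (intro runs_NPut) (auto simp: s1_def I_def)
      show "runs (Seq ?p2 ?sc) t1 (3 + 3 * row_nnz M i) (I (Suc t))" if "t1 = s1" for t1
        unfolding that
      proof (rule runs_Seq)
        show "runs ?p2 s1 1 (\<lambda>s. s = s2)"
          using gi by (intro runs_RPut) (auto simp: s2_def s1_def q_def put_def)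
        show "runs ?sc t2 (2 + 3 * row_nnz M i) (I (Suc t))" if "t2 = s2" for t2
          unfolding that
        proof (rule runs_weaken[OF runs_scatter_row[OF input_simps(6)[OF s2(1)]]])
          fix s3 assume ag3: "agree_outside (nat_writes ?sc) (real_writes ?sc) s2 s3"
            and u3: "\<forall>j<dim_col M. reals s3 ''u'' j
              = reals s2 ''u'' j - M $$ (nats s2 ''i'' 0, j) * reals s2 ''v'' (nats s2 ''i'' 0)"
          have v3: "reals s3 ''v'' = (reals s' ''v'')(i := q)" and i3: "nats s3 ''i'' 0 = i"
            using ag3 s2 by (simp_all add: agree_outside_def)
          have u3': "reals s3 ''u'' j = reals s' ''u'' j - M $$ (i, j) * q" if "j < n" for j
            using u3 s2 M that by simp
          have vi: "reals s' ''v'' i = 0"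
            using I i by (simp add: I_def)
          \<comment> \<open>As \<open>v i\<close> was 0, writing \<open>q\<close> there changes
            column sum \<open>j\<close> by exactly the amount subtracted from
            \<open>u j\<close>.\<close>
          have sum3: "(\<Sum>k<n. M $$ (k, j) * reals s3 ''v'' k)
              = (\<Sum>k<n. M $$ (k, j) * reals s' ''v'' k) + M $$ (i, j) * q" for j
            using i vi by (simp add: v3 sum.remove[of "{..<n}" i])
          have "(\<Sum>k<n. M $$ (k, j) * reals s3 ''v'' k) = ud j" if j: "i \<le> j" "Suc j < n" for j
          proof (cases "j = i")
            case True
            then show ?thesis
              using I i pivots(1)[OF i(2)] by (simp add: sum3 q_def I_def)
          next
            case False
            then show ?thesis
              using I i j M_upper[of i j] by (simp add: sum3 I_def)
          qed
          moreover have "reals s3 ''u'' j = ud j - (\<Sum>k<n. M $$ (k, j) * reals s3 ''v'' k)" if "j < i" for j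
            using I i that u3'[of j] by (simp add: sum3 I_def)
          moreover have "reals s3 ''v'' j = 0" if "j < i" for j
            using I i that by (simp add: I_def v3)
          ultimately show "I (Suc t) s3"
            using i3 by (simp only: I_def i_def[symmetric]) simp
        qed (use M i s2 in auto)
      qed simp
    qed simp
  qed
  moreover have "runs (NPut ''i'' (NConst 0) (NSub (cell ''n'') (NConst 1))) s 1 (\<lambda>s. s = s0)"
    using input_simps(1)[OF assms(1)] by (intro runs_NPut) (auto simp: s0_def)
  moreover have "1 + (1 + (\<Sum>t<n - 1. (4 + 3 * row_nnz M (n - 1 - Suc t)) + 1)) \<le> 2 + 5 * n + 3 * nnz M"
  proof -
    have "(\<Sum>t<n - 1. row_nnz M (n - 1 - Suc t)) = (\<Sum>t<n - 1. row_nnz M t)"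
      by (rule sum.nat_diff_reindex)
    also have "\<dots> \<le> (\<Sum>k=0..<n. row_nnz M k)"
      by (intro sum_mono2) auto
    finally show ?thesis
      using sum_row_nnz_M by (simp add: sum.distrib flip: sum_distrib_left)
  qed
  ultimately have "runs backward_prog s (2 + 5 * n + 3 * nnz M) (I (n - 1))"
    unfolding backward_prog_def by (auto intro: runs_Seq[where Q = "\<lambda>s. s = s0"])
  then show ?thesis
    by (rule runs_weaken) (auto simp: I_def)
qed

lemma runs_total:
  assumes "input s"
  shows "runs total_prog s (3 + 3 * n) (\<lambda>s'. reals s' ''s'' 0 = (\<Sum>k<n. reals s ''v'' k))"
proof -
  let ?c = "RPut ''s'' (NConst 0) (RAdd (scalar ''s'') (RGet ''v'' row_index))"
  define s0 where "s0 = s\<lparr>reals := put (reals s) ''s'' 0 0\<rparr>"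
  define I where "I k R \<longleftrightarrow> R ''s'' 0 = (\<Sum>j<k. reals s ''v'' j)" for k and R :: "name \<Rightarrow> nat \<Rightarrow> real"
  have "runs (count_loop ''i'' (NConst 0) (cell ''n'') ?c) s0 (2 + 3 * n) (\<lambda>s'. I n (reals s'))"
  proof (rule runs_count_loop)
    show "''i'' \<notin> nat_writes ?c"
      by simp
    show "nval (cell ''n'') s' = n"
      if "agree_outside (insert ''i'' (nat_writes ?c)) (real_writes ?c) s0 s'" for s'
      using that input_simps(1)[OF assms] by (simp add: agree_outside_def s0_def)
    show "runs ?c s' 1 (\<lambda>s''. I (Suc k) (reals s''))"
      if "I k (reals s')" "nats s' ''i'' 0 = k"
        "agree_outside (insert ''i'' (nat_writes ?c)) (real_writes ?c) s0 s'" for k s'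
      using that by (intro runs_RPut) (auto simp: I_def put_def agree_outside_def s0_def)
  qed (auto simp: I_def s0_def put_def)
  moreover have "runs (RPut ''s'' (NConst 0) (RConst 0)) s 1 (\<lambda>s. s = s0)"
    by (intro runs_RPut) (auto simp: s0_def)
  ultimately have "runs total_prog s (3 + 3 * n) (\<lambda>s'. I n (reals s'))"
    unfolding total_prog_def by (auto intro: runs_Seq[where Q = "\<lambda>s. s = s0"])
  then show ?thesis
    by (simp add: I_def)
qed

lemma runs_update:
  assumes "input s" and r: "reals s ''r'' 0 = real n"
  shows "runs update_prog s (2 + 3 * n) (\<lambda>s'. \<forall>i<n. reals s' ''x'' i
    = reals s ''x'' i - (reals s ''v'' (p i) - reals s ''s'' 0 / real n) / 2)"
proof -
  let ?c = "RPut ''x'' row_index (RSub (RGet ''x'' row_index)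
       (RDiv (RSub (RGet ''v'' (NGet ''P'' row_index)) (RDiv (scalar ''s'') (scalar ''r''))) (RConst 2)))"
  \<comment> \<open>Cells not yet reached are described too, because the update is in place and
    reads the old value of \<open>x\<close>.\<close>
  define I where "I k R \<longleftrightarrow> (\<forall>i. R ''x'' i = (if i < k
      then reals s ''x'' i - (reals s ''v'' (p i) - reals s ''s'' 0 / real n) / 2 else reals s ''x'' i))"
    for k and R :: "name \<Rightarrow> nat \<Rightarrow> real"
  have "runs update_prog s (2 + 3 * n) (\<lambda>s'. I n (reals s'))"
    unfolding update_prog_def
  proof (rule runs_count_loop)
    show "''i'' \<notin> nat_writes ?c"
      by simp
    show "nval (cell ''n'') s' = n"
      if "agree_outside (insert ''i'' (nat_writes ?c)) (real_writes ?c) s s'" for s'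
      using that input_simps(1)[OF assms(1)] by (simp add: agree_outside_def)
    fix k s'
    assume k: "nval (NConst 0) s \<le> k" "k < n" and I: "I k (reals s')" and i: "nats s' ''i'' 0 = k"
      and ag: "agree_outside (insert ''i'' (nat_writes ?c)) (real_writes ?c) s s'"
    have "reals s' ''v'' = reals s ''v''" "reals s' ''s'' = reals s ''s''" "reals s' ''r'' = reals s ''r''"
      "nats s' ''P'' = nats s ''P''"
      using ag by (simp_all add: agree_outside_def)
    then show "runs ?c s' 1 (\<lambda>s''. I (Suc k) (reals s''))"
      using I i k r input_perm[OF assms(1)]
      by (intro runs_RPut) (auto simp: I_def put_def less_Suc_eq)
  qed (auto simp: I_def)
  then show ?thesis
    by (rule runs_weaken) (auto simp: I_def)
qed

lemma runs_clear:
  assumes "input s"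
  shows "runs clear_prog s (3 + 5 * n)
    (\<lambda>s'. (\<forall>i<n. reals s' ''x'' i = 0 \<and> reals s' ''e'' i = 0) \<and> reals s' ''r'' 0 = real n)"
proof -
  let ?p1 = "RPut ''x'' row_index (RConst 0)" and ?p2 = "RPut ''e'' row_index (RConst 0)"
    and ?p3 = "RPut ''r'' (NConst 0) (RAdd (scalar ''r'') (RConst 1))"
  let ?c = "Seq ?p1 (Seq ?p2 ?p3)"
  define s0 where "s0 = s\<lparr>reals := put (reals s) ''r'' 0 0\<rparr>"
  define I where "I k R \<longleftrightarrow> (\<forall>i<k. R ''x'' i = 0 \<and> R ''e'' i = 0) \<and> R ''r'' 0 = real k"
    for k and R :: "name \<Rightarrow> nat \<Rightarrow> real"
  have "runs (count_loop ''i'' (NConst 0) (cell ''n'') ?c) s0 (2 + 5 * n) (\<lambda>s'. I n (reals s'))"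
  proof (rule runs_count_loop)
    show "''i'' \<notin> nat_writes ?c"
      by simp
    show "nval (cell ''n'') s' = n"
      if "agree_outside (insert ''i'' (nat_writes ?c)) (real_writes ?c) s0 s'" for s'
      using that input_simps(1)[OF assms] by (simp add: agree_outside_def s0_def)
    fix k and s' :: state assume I: "I k (reals s')" and i: "nats s' ''i'' 0 = k"
    define s1 where "s1 = s'\<lparr>reals := put (reals s') ''x'' k 0\<rparr>"
    define s2 where "s2 = s1\<lparr>reals := put (reals s1) ''e'' k 0\<rparr>"
    show "runs ?c s' 3 (\<lambda>s''. I (Suc k) (reals s''))"
    proof (rule runs_Seq)
      show "runs ?p1 s' 1 (\<lambda>s. s = s1)"
        using i by (intro runs_RPut) (auto simp: s1_def)
      show "runs (Seq ?p2 ?p3) t 2 (\<lambda>s''. I (Suc k) (reals s''))" if "t = s1" for t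
        unfolding that
      proof (rule runs_Seq)
        show "runs ?p2 s1 1 (\<lambda>s. s = s2)"
          using i by (intro runs_RPut) (auto simp: s2_def s1_def)
        show "runs ?p3 t 1 (\<lambda>s''. I (Suc k) (reals s''))" if "t = s2" for t
          using that I by (intro runs_RPut) (auto simp: I_def put_def s2_def s1_def less_Suc_eq)
      qed simp
    qed simp
  qed (auto simp: I_def s0_def put_def)
  moreover have "runs (RPut ''r'' (NConst 0) (RConst 0)) s 1 (\<lambda>s. s = s0)"
    by (intro runs_RPut) (auto simp: s0_def)
  ultimately have "runs clear_prog s (3 + 5 * n) (\<lambda>s'. I n (reals s'))"
    unfolding clear_prog_def by (auto intro: runs_Seq[where Q = "\<lambda>s. s = s0"])
  then show ?thesis
    by (simp add: I_def)
qed

section \<open>One step of the iteration and the whole solver\<close>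

lemma residual_sum_eq_0:
  assumes X: "X \<in> carrier_vec n"
  shows "all_ones n \<bullet> (L *\<^sub>v X - b) = 0"
proof -
  have "L\<^sup>T = L" and L1: "L *\<^sub>v all_ones n = 0\<^sub>v n"
    using L unfolding kernel_is_constants_def by (simp, metis all_ones_carrier one_smult_vec)
  then have "all_ones n \<bullet> (L *\<^sub>v X) = 0"
    using symmetric_form_commute[OF L_carrier _ all_ones_carrier X] X by simp
  then show ?thesis
    using L_carrier X b by (subst scalar_prod_minus_distrib[of _ n]) auto
qed

text \<open>Except at the last index, the passes achieve \<open>M w = y\<close>,
  \<open>u = w / D\<close> before elimination, and \<open>M^T v = w / D\<close>. The step bound is
  the sum of those of the six passes.\<close>

lemma runs_step:
  assumes "input s" and g: "\<forall>i<n. reals s ''g'' i = M $$ (i, i)" and r: "reals s ''r'' 0 = real n"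
    and X: "X \<in> carrier_vec n" and x: "\<forall>i<n. reals s ''x'' i = X $ i"
  shows "runs step_prog s (13 + 28 * n + 3 * nnz L + 6 * nnz M)
    (\<lambda>s'. \<forall>i<n. reals s' ''x'' i = (X - (1/2) \<cdot>\<^sub>v (pinv (factored P M D) *\<^sub>v (L *\<^sub>v X - b))) $ i)"
  unfolding step_prog_def
proof (rule runs_Seq[OF runs_residual[OF assms(1)]])
  fix s1
  assume ag1: "agree_outside (nat_writes residual_prog) (real_writes residual_prog) s s1"
    and y: "\<forall>i<n. reals s1 ''y'' (p i) = (\<Sum>j<n. L $$ (i, j) * reals s ''x'' j) - b $ i"
  let ?y = "reals s1 ''y''"
  have in1: "input s1"
    using input_state_agree_outside[OF assms(1) ag1] by (simp add: work_reals_def)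
  have e1: "reals s1 ''g'' = reals s ''g''" "reals s1 ''r'' = reals s ''r''" "reals s1 ''x'' = reals s ''x''"
    using ag1 by (simp_all add: agree_outside_def)
  have y_vec: "vec n (\<lambda>i. ?y (p i)) = L *\<^sub>v X - b"
  proof (rule eq_vecI)
    fix i assume i: "i < dim_vec (L *\<^sub>v X - b)"
    then have "i < n"
      using b by simp
    then show "vec n (\<lambda>i. ?y (p i)) $ i = (L *\<^sub>v X - b) $ i"
      using y x i b L_carrier X index_mult_mat_vec_sum[OF L_carrier X, of i]
      by (auto simp del: index_mult_mat_vec intro!: sum.cong)
  qed (use b in simp)
  have "(\<Sum>i<n. ?y i) = (\<Sum>i<n. ?y (p i))"
    using sum.permute[OF p, of ?y] by (simp add: o_def)
  also have "\<dots> = all_ones n \<bullet> vec n (\<lambda>i. ?y (p i))"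
    by (subst all_ones_scalar_prod) auto
  also have "\<dots> = 0"
    using residual_sum_eq_0[OF X] by (simp add: y_vec)
  finally have y0: "(\<Sum>i<n. ?y i) = 0" .
  show "runs (Seq forward_prog (Seq scale_prog (Seq backward_prog (Seq total_prog update_prog)))) s1
      (11 + 22 * n + 6 * nnz M)
      (\<lambda>s'. \<forall>i<n. reals s' ''x'' i = (X - (1/2) \<cdot>\<^sub>v (pinv (factored P M D) *\<^sub>v (L *\<^sub>v X - b))) $ i)"
  proof (rule runs_Seq[OF runs_forward[OF in1]])
    show "\<forall>i<n. reals s1 ''g'' i = M $$ (i, i)"
      using g e1 by simp
    fix s2
    assume ag2: "agree_outside (nat_writes forward_prog) (real_writes forward_prog) s1 s2"
      and fw: "\<forall>i. Suc i < n \<longrightarrow> (\<Sum>j<n. M $$ (i, j) * reals s2 ''w'' j) = ?y i"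
    have in2: "input s2"
      using input_state_agree_outside[OF in1 ag2] by (simp add: work_reals_def)
    have e2: "reals s2 ''g'' = reals s ''g''" "reals s2 ''r'' = reals s ''r''" "reals s2 ''x'' = reals s ''x''"
      using ag2 e1 by (simp_all add: agree_outside_def)
    show "runs (Seq scale_prog (Seq backward_prog (Seq total_prog update_prog))) s2 (9 + 15 * n + 3 * nnz M)
        (\<lambda>s'. \<forall>i<n. reals s' ''x'' i = (X - (1/2) \<cdot>\<^sub>v (pinv (factored P M D) *\<^sub>v (L *\<^sub>v X - b))) $ i)"
    proof (rule runs_Seq[OF runs_scale[OF in2]])
      fix s3
      assume ag3: "agree_outside (nat_writes scale_prog) (real_writes scale_prog) s2 s3"
        and u: "\<forall>i<n. reals s3 ''u'' i = reals s2 ''w'' i / D $$ (i, i) \<and> reals s3 ''v'' i = 0"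
      have in3: "input s3"
        using input_state_agree_outside[OF in2 ag3] by (simp add: work_reals_def)
      have e3: "reals s3 ''g'' = reals s ''g''" "reals s3 ''r'' = reals s ''r''" "reals s3 ''x'' = reals s ''x''"
        using ag3 e2 by (simp_all add: agree_outside_def)
      have g3: "\<forall>i<n. reals s3 ''g'' i = M $$ (i, i)"
        using g e3 by simp
      show "runs (Seq backward_prog (Seq total_prog update_prog)) s3 (7 + 11 * n + 3 * nnz M)
          (\<lambda>s'. \<forall>i<n. reals s' ''x'' i = (X - (1/2) \<cdot>\<^sub>v (pinv (factored P M D) *\<^sub>v (L *\<^sub>v X - b))) $ i)"
      proof (rule runs_Seq[OF runs_backward[OF in3 g3 u]])
        fix s4
        assume ag4: "agree_outside (nat_writes backward_prog) (real_writes backward_prog) s3 s4"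
          and bw: "\<forall>j. Suc j < n \<longrightarrow> (\<Sum>k<n. M $$ (k, j) * reals s4 ''v'' k) = reals s2 ''w'' j / D $$ (j, j)"
        let ?v = "reals s4 ''v''"
        have in4: "input s4"
          using input_state_agree_outside[OF in3 ag4] by (simp add: work_reals_def)
        have e4: "reals s4 ''r'' = reals s ''r''" "reals s4 ''x'' = reals s ''x''"
          using ag4 e3 by (simp_all add: agree_outside_def)
        \<comment> \<open>Non-zero pivots turn \<open>M^T v = w / D\<close> into
          \<open>D M^T v = w\<close>, the form in which the backward system is required.\<close>
        have sol: "pinv (factored P M D) *\<^sub>v (L *\<^sub>v X - b) = vec n (\<lambda>i. ?v (p i) - (\<Sum>k<n. ?v k) / real n)"
          unfolding y_vec[symmetric]
          by (rule factored_solve[OF p P M D Z y0, of "reals s2 ''w''"]) (use fw bw pivots in auto)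
        show "runs (Seq total_prog update_prog) s4 (5 + 6 * n)
            (\<lambda>s'. \<forall>i<n. reals s' ''x'' i = (X - (1/2) \<cdot>\<^sub>v (pinv (factored P M D) *\<^sub>v (L *\<^sub>v X - b))) $ i)"
        proof (rule runs_Seq[OF runs_total[OF in4]])
          fix s5
          assume ag5: "agree_outside (nat_writes total_prog) (real_writes total_prog) s4 s5"
            and S: "reals s5 ''s'' 0 = (\<Sum>k<n. ?v k)"
          have in5: "input s5"
            using input_state_agree_outside[OF in4 ag5] by (simp add: work_reals_def)
          have e5: "reals s5 ''r'' = reals s ''r''" "reals s5 ''x'' = reals s ''x''" "reals s5 ''v'' = ?v"
            using ag5 e4 by (simp_all add: agree_outside_def)
          have r5: "reals s5 ''r'' 0 = real n"
            using e5 r by simp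
          show "runs update_prog s5 (2 + 3 * n)
              (\<lambda>s'. \<forall>i<n. reals s' ''x'' i = (X - (1/2) \<cdot>\<^sub>v (pinv (factored P M D) *\<^sub>v (L *\<^sub>v X - b))) $ i)"
            by (rule runs_weaken[OF runs_update[OF in5 r5]]) (use x X e5 S in \<open>auto simp: sol\<close>)
        qed simp
      qed simp
    qed simp
  qed simp
qed simp

lemma iterate_carrier: "iterate L (factored P M D) b t \<in> carrier_vec n"
proof (induction t)
  case (Suc t)
  show ?case
    using Suc pinv_kernel_is_constants(1)[OF Z] L_carrier b
    by (auto intro!: minus_carrier_vec mult_mat_vec_carrier[of _ n n])
qed (use L_carrier in simp)

text \<open>A round adds 2 to the cost of \<open>step_prog\<close>, for the counter and the test, so
  13 becomes 15. Clearing and extracting the diagonal cost no more than one further round, hence the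
  factor \<open>num_iterations \<epsilon> + 1\<close>.\<close>

lemma runs_solver:
  assumes "input s"
  shows "runs solver_prog s ((num_iterations \<epsilon> + 1) * (15 + 28 * n + 3 * nnz L + 6 * nnz M))
    (\<lambda>s'. outputs s' (iterate L (factored P M D) b (num_iterations \<epsilon>)))"
proof -
  let ?N = "num_iterations \<epsilon>" and ?x = "iterate L (factored P M D) b"
    and ?cost = "13 + 28 * n + 3 * nnz L + 6 * nnz M"
  let ?inc = "RPut ''c'' (NConst 0) (RAdd (scalar ''c'') (RConst 1))"
    and ?guard = "RLess (scalar ''c'') (RMul (RConst 3) (RLn (RDiv (RConst 1) (scalar ''eps''))))"
  let ?c = "Seq step_prog ?inc"
  define I :: "nat \<Rightarrow> state \<Rightarrow> bool"
    where "I t s' \<longleftrightarrow> (\<forall>i<n. reals s' ''x'' i = ?x t $ i) \<and> reals s' ''c'' 0 = real t" for t s'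
  have loop: "runs (Loop ?guard ?c) s3 (1 + ?N * (?cost + 2)) (I ?N)"
    if in3: "input s3" and g: "\<forall>i<n. reals s3 ''g'' i = M $$ (i, i)" and r: "reals s3 ''r'' 0 = real n"
      and I0: "I 0 s3" for s3
  proof -
    have "runs (Loop ?guard ?c) s3 (1 + (\<Sum>t<?N. (?cost + 1) + 1)) (I ?N)"
    proof (rule runs_Loop[where I = I, OF I0])
      fix t s' assume I: "I t s'" and ag: "agree_outside (nat_writes ?c) (real_writes ?c) s3 s'"
      have in': "input s'"
        using input_state_agree_outside[OF in3 ag] by (simp add: work_reals_def)
      \<comment> \<open>An integer lies below a real exactly if it lies below its ceiling; for a
        non-positive bound both sides are false.\<close>
      show "bval ?guard s' \<longleftrightarrow> t < ?N"
        using I input_simps(2)[OF in'] unfolding num_iterations_def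
        by (simp add: I_def zless_nat_eq_int_zless less_ceiling_iff)
      have g': "\<forall>i<n. reals s' ''g'' i = M $$ (i, i)" and r': "reals s' ''r'' 0 = real n"
        using ag g r by (simp_all add: agree_outside_def)
      show "runs ?c s' (?cost + 1) (I (Suc t))"
      proof (rule runs_Seq[OF runs_step[OF in' g' r' iterate_carrier]])
        show "\<forall>i<n. reals s' ''x'' i = ?x t $ i"
          using I by (simp add: I_def)
        fix s'' assume ag': "agree_outside (nat_writes step_prog) (real_writes step_prog) s' s''"
          and x: "\<forall>i<n. reals s'' ''x'' i
            = (?x t - (1/2) \<cdot>\<^sub>v (pinv (factored P M D) *\<^sub>v (L *\<^sub>v ?x t - b))) $ i"
        have "reals s'' ''c'' = reals s' ''c''"
          using ag' by (simp add: agree_outside_def)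
        then show "runs ?inc s'' 1 (I (Suc t))"
          using x I by (intro runs_RPut) (simp_all add: I_def put_def)
      qed simp
    qed
    then show ?thesis
      by (simp add: algebra_simps)
  qed
  have "runs solver_prog s (8 + 13 * n + 3 * nnz M + ?N * (?cost + 2)) (I ?N)"
    unfolding solver_prog_def
  proof (rule runs_Seq[OF runs_clear[OF assms]])
    fix s1
    assume ag1: "agree_outside (nat_writes clear_prog) (real_writes clear_prog) s s1"
      and c: "(\<forall>i<n. reals s1 ''x'' i = 0 \<and> reals s1 ''e'' i = 0) \<and> reals s1 ''r'' 0 = real n"
    have in1: "input s1"
      using input_state_agree_outside[OF assms ag1] by (simp add: work_reals_def)
    have e: "\<forall>i<n. reals s1 ''e'' i = 0"
      using c by simp
    let ?p = "RPut ''c'' (NConst 0) (RConst 0)"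
    show "runs (Seq diagonal_prog (Seq ?p (Loop ?guard ?c))) s1 (5 + 8 * n + 3 * nnz M + ?N * (?cost + 2)) (I ?N)"
    proof (rule runs_Seq[OF runs_diagonal[OF in1 e]])
      fix s2
      assume ag2: "agree_outside (nat_writes diagonal_prog) (real_writes diagonal_prog) s1 s2"
        and g: "\<forall>i<n. reals s2 ''g'' i = M $$ (i, i)"
      have in2: "input s2"
        using input_state_agree_outside[OF in1 ag2] by (simp add: work_reals_def)
      have e2: "reals s2 ''x'' = reals s1 ''x''" "reals s2 ''r'' = reals s1 ''r''"
        using ag2 by (simp_all add: agree_outside_def)
      define s3 where "s3 = s2\<lparr>reals := put (reals s2) ''c'' 0 0\<rparr>"
      show "runs (Seq ?p (Loop ?guard ?c)) s2 (3 + ?N * (?cost + 2)) (I ?N)"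
      proof (rule runs_Seq)
        show "runs ?p s2 1 (\<lambda>s. s = s3)"
          by (intro runs_RPut) (auto simp: s3_def)
        have "input s3"
          using in2 by (simp add: s3_def input_state_def put_def)
        moreover have "I 0 s3"
          using c e2 L_carrier by (simp add: I_def s3_def put_def)
        ultimately show "runs (Loop ?guard ?c) t (1 + ?N * (?cost + 2)) (I ?N)" if "t = s3" for t
          unfolding that using g c e2 by (intro loop) (simp_all add: s3_def put_def)
      qed simp
    qed simp
  qed simp
  then show ?thesis
    by (rule runs_weaken) (use carrier_vecD[OF iterate_carrier] in \<open>auto simp: I_def outputs_def algebra_simps\<close>)
qed

end

section \<open>The final cost estimate\<close>

lemma le_nnz_laplacian:
  assumes conn: "connected_multigraph n E" and n: "2 \<le> n"
  shows "n \<le> nnz (laplacian n E)"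
proof -
  let ?L = "laplacian n E"
  \<comment> \<open>A diagonal entry is the form at a unit vector, which is not constant once there
    are two vertices. For \<open>n = 1\<close> the Laplacian is 0 and the bound fails.\<close>
  have diag: "?L $$ (i, i) \<noteq> 0" if i: "i < n" for i
  proof
    assume "?L $$ (i, i) = 0"
    moreover have "unit_vec n i \<bullet> (?L *\<^sub>v unit_vec n i) = ?L $$ (i, i)"
      using i laplacian_carrier[of n E] by (simp add: mult_mat_vec_def laplacian_def)
    ultimately obtain c where c: "unit_vec n i = c \<cdot>\<^sub>v all_ones n"
      using laplacian_form_eq_0[OF conn, of "unit_vec n i"] by auto
    define j where "j = (if i = 0 then 1 else 0 :: nat)"
    have "j < n" "j \<noteq> i"
      using n by (auto simp: j_def)
    then show False
      using arg_cong[OF c, of "\<lambda>v. v $ i"] arg_cong[OF c, of "\<lambda>v. v $ j"] i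
      by (simp add: all_ones_def)
  qed
  let ?S = "{(i, j). i < dim_row ?L \<and> j < dim_col ?L \<and> ?L $$ (i, j) \<noteq> 0}"
  have "finite ?S"
    by (rule finite_subset[of _ "{..<n} \<times> {..<n}"]) (auto simp: laplacian_def)
  moreover have "(\<lambda>i. (i, i)) ` {..<n} \<subseteq> ?S"
    using diag by (auto simp: laplacian_def[of n E, THEN arg_cong[of _ _ dim_row]]
        laplacian_def[of n E, THEN arg_cong[of _ _ dim_col]])
  ultimately have "card ((\<lambda>i. (i, i)) ` {..<n}) \<le> card ?S"
    by (rule card_mono)
  then show ?thesis
    by (simp add: nnz_def card_image inj_on_def)
qed

text \<open>With \<open>l = max 1 (ln (1 / \<epsilon>))\<close>, rounding up adds 1 to at most
  \<open>3 l\<close> and the extra round another 1, and \<open>3 l + 2 \<le> 5 l\<close>.\<close>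

lemma num_iterations_le: "real (num_iterations \<epsilon>) + 1 \<le> 5 * max 1 (ln (1 / \<epsilon>))"
proof -
  have "real (num_iterations \<epsilon>) \<le> max 0 (3 * ln (1 / \<epsilon>) + 1)"
    unfolding num_iterations_def by linarith
  then show ?thesis
    by (auto simp: max_def split: if_splits)
qed

text \<open>46 is \<open>15 + 28 + 3\<close>, with 1 and \<open>n\<close> replaced by
  \<open>m\<close>. The plain \<open>m\<close> is absorbed because \<open>ln 2 \<le> ln n\<close>,
  and the absolute value of \<open>K\<close> keeps the constant non-negative.\<close>

lemma solver_cost_bound:
  fixes t n m k :: nat
  assumes n: "2 \<le> n" "n \<le> m" and k: "real k \<le> K * (real m * ln (real n) ^ 3)"
    and t: "real t + 1 \<le> 5 * l"
  shows "real ((t + 1) * (15 + 28 * n + 3 * m + 6 * k))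
    \<le> 5 * (46 / ln 2 ^ 3 + 6 * \<bar>K\<bar>) * (real m * ln (real n) ^ 3 * l)"
proof -
  let ?q = "real m * ln (real n) ^ 3"
  have l2: "0 < ln (2::real) ^ 3"
    by simp
  have "ln (2::real) ^ 3 \<le> ln (real n) ^ 3"
    using n by (intro power_mono) auto
  then have "real m * ln 2 ^ 3 \<le> ?q"
    by (intro mult_left_mono) auto
  then have m: "real m \<le> ?q / ln 2 ^ 3"
    using l2 by (simp add: pos_le_divide_eq)
  have q: "0 \<le> ?q"
    using n by simp
  have "K * ?q \<le> \<bar>K\<bar> * ?q"
    using q by (intro mult_right_mono) auto
  then have k': "real k \<le> \<bar>K\<bar> * ?q"
    using k by linarith
  have "real (15 + 28 * n + 3 * m + 6 * k) \<le> 46 * real m + 6 * real k"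
    using n by simp
  also have "\<dots> \<le> 46 * (?q / ln 2 ^ 3) + 6 * (\<bar>K\<bar> * ?q)"
    using m k' by linarith
  also have "\<dots> = (46 / ln 2 ^ 3 + 6 * \<bar>K\<bar>) * ?q"
    by (simp add: algebra_simps)
  finally have "(real t + 1) * real (15 + 28 * n + 3 * m + 6 * k)
      \<le> (5 * l) * ((46 / ln 2 ^ 3 + 6 * \<bar>K\<bar>) * ?q)"
    using t by (intro mult_mono) auto
  then show ?thesis
    by (simp add: algebra_simps)
qed

text \<open>The program precedes the sparsity constant \<open>K\<close>, and \<open>C\<close>
  depends on \<open>K\<close> alone. The cost carries \<open>max 1\<close> because the set-up is
  paid even when \<open>\<epsilon>\<close> is close to or above 1, and it assumes
  \<open>2 \<le> n\<close> because \<open>ln 1 = 0\<close>.\<close>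

theorem theorem1p2:
  shows "\<exists>prog. \<forall>K::real. \<exists>C::real.
    \<forall>(n::nat) (E::multigraph) (P::real mat) (M::real mat) (D::real mat) (b::real vec) (\<epsilon>::real).
      let L = laplacian n E; m = nnz L; Z = factored P M D; x = iterate L Z b (num_iterations \<epsilon>) in
      connected_multigraph n E \<longrightarrow>
      approx_factorization n L P M D \<longrightarrow>
      b \<in> carrier_vec n \<longrightarrow> all_ones n \<bullet> b = 0 \<longrightarrow> 0 < \<epsilon> \<longrightarrow>
        lap_norm L (x - pinv L *\<^sub>v b) \<le> \<epsilon> * lap_norm L (pinv L *\<^sub>v b) \<and>
        (2 \<le> n \<and> real (nnz M) \<le> K * (real m * ln (real n) ^ 3) \<longrightarrow>
          (\<forall>s. input_state n L P M D b \<epsilon> s \<longrightarrow>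
            (\<exists>T s'. exec prog s T s' \<and> outputs s' x \<and>
              real T \<le> C * (real m * ln (real n) ^ 3 * max 1 (ln (1 / \<epsilon>))))))"
proof (intro exI[of _ solver_prog] allI)
  fix K :: real
  let ?C = "5 * (46 / ln 2 ^ 3 + 6 * \<bar>K\<bar>)"
  have main: "lap_norm (laplacian n E) (iterate (laplacian n E) (factored P M D) b (num_iterations \<epsilon>)
        - pinv (laplacian n E) *\<^sub>v b) \<le> \<epsilon> * lap_norm (laplacian n E) (pinv (laplacian n E) *\<^sub>v b) \<and>
      (2 \<le> n \<and> real (nnz M) \<le> K * (real (nnz (laplacian n E)) * ln (real n) ^ 3) \<longrightarrow>
        (\<forall>s. input_state n (laplacian n E) P M D b \<epsilon> s \<longrightarrow>
          (\<exists>T s'. exec solver_prog s T s' \<and>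
            outputs s' (iterate (laplacian n E) (factored P M D) b (num_iterations \<epsilon>)) \<and>
            real T \<le> ?C * (real (nnz (laplacian n E)) * ln (real n) ^ 3 * max 1 (ln (1 / \<epsilon>))))))"
    if conn: "connected_multigraph n E" and approx: "approx_factorization n (laplacian n E) P M D"
      and b: "b \<in> carrier_vec n" "all_ones n \<bullet> b = 0" and \<epsilon>: "0 < \<epsilon>"
    for n E P M D b \<epsilon>
  proof (intro conjI impI allI)
    let ?L = "laplacian n E" and ?Z = "factored P M D" and ?N = "num_iterations \<epsilon>"
    have psd: "psd ?L"
      using conn by (intro psd_laplacian) (simp add: connected_multigraph_def)
    have L: "kernel_is_constants n ?L"
      using conn by (rule kernel_is_constants_laplacian)
    obtain p where p: "p permutes {..<n}" and P: "P = mat n n (\<lambda>(i, j). if j = p i then 1 else 0)"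
      and M: "M \<in> carrier_mat n n" "lower_triangular M" and D: "D \<in> carrier_mat n n" "diagonal_mat D"
      and lo: "loewner_le ((1/2) \<cdot>\<^sub>m ?L) ?Z" and hi: "loewner_le ?Z ((3/2) \<cdot>\<^sub>m ?L)"
      using approx by (auto simp: approx_factorization_def permutation_mat_def)
    have Zc: "?Z \<in> carrier_mat n n"
      by (rule carrier_matI) (simp_all add: factored_def P)
    note Z = kernel_is_constants_sandwiched[OF L psd Zc lo hi]
    have nn: "0 \<le> x \<bullet> (?L *\<^sub>v x)" if "x \<in> carrier_vec n" for x
      using psd that carrier_matD[OF laplacian_carrier[of n E]] by (simp add: psd_def)
    have nonneg: "0 \<le> lap_norm ?L (pinv ?L *\<^sub>v b)"
      using nn[OF mult_mat_vec_carrier[OF pinv_kernel_is_constants(1)[OF L] b(1)]]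
      by (simp add: lap_norm_def)
    have "lap_norm ?L (iterate ?L ?Z b ?N - pinv ?L *\<^sub>v b) \<le> (2/3) ^ ?N * lap_norm ?L (pinv ?L *\<^sub>v b)"
      using lap_norm_iterate[OF L Z(1) nn Z(2,3) b, of ?N] by blast
    also have "(2/3) ^ ?N * lap_norm ?L (pinv ?L *\<^sub>v b) \<le> \<epsilon> * lap_norm ?L (pinv ?L *\<^sub>v b)"
      using nonneg power_num_iterations[OF \<epsilon>] by (intro mult_right_mono)
    finally show "lap_norm ?L (iterate ?L ?Z b ?N - pinv ?L *\<^sub>v b) \<le> \<epsilon> * lap_norm ?L (pinv ?L *\<^sub>v b)" .
    fix s
    assume nM: "2 \<le> n \<and> real (nnz M) \<le> K * (real (nnz ?L) * ln (real n) ^ 3)"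
      and s: "input_state n ?L P M D b \<epsilon> s"
    interpret factored_system n ?L P M D b \<epsilon> p
      using L p P M D Z(1) b by unfold_locales
    obtain T s' where T: "exec solver_prog s T s'" "outputs s' (iterate ?L ?Z b ?N)"
      "T \<le> (?N + 1) * (15 + 28 * n + 3 * nnz ?L + 6 * nnz M)"
      using runs_solver[OF s] by (auto simp: runs_def)
    have "real T \<le> real ((?N + 1) * (15 + 28 * n + 3 * nnz ?L + 6 * nnz M))"
      using T(3) by (rule of_nat_mono)
    also have "\<dots> \<le> ?C * (real (nnz ?L) * ln (real n) ^ 3 * max 1 (ln (1 / \<epsilon>)))"
      using nM le_nnz_laplacian[OF conn] num_iterations_le by (intro solver_cost_bound) auto
    finally show "\<exists>T s'. exec solver_prog s T s' \<and> outputs s' (iterate ?L ?Z b ?N) \<and>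
        real T \<le> ?C * (real (nnz ?L) * ln (real n) ^ 3 * max 1 (ln (1 / \<epsilon>)))"
      using T by blast
  qed
  show "\<exists>C::real. \<forall>n E P M D b \<epsilon>.
      let L = laplacian n E; m = nnz L; Z = factored P M D; x = iterate L Z b (num_iterations \<epsilon>) in
      connected_multigraph n E \<longrightarrow>
      approx_factorization n L P M D \<longrightarrow>
      b \<in> carrier_vec n \<longrightarrow> all_ones n \<bullet> b = 0 \<longrightarrow> 0 < \<epsilon> \<longrightarrow>
        lap_norm L (x - pinv L *\<^sub>v b) \<le> \<epsilon> * lap_norm L (pinv L *\<^sub>v b) \<and>
        (2 \<le> n \<and> real (nnz M) \<le> K * (real m * ln (real n) ^ 3) \<longrightarrow>
          (\<forall>s. input_state n L P M D b \<epsilon> s \<longrightarrow>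
            (\<exists>T s'. exec solver_prog s T s' \<and> outputs s' x \<and>
              real T \<le> C * (real m * ln (real n) ^ 3 * max 1 (ln (1 / \<epsilon>))))))"
    unfolding Let_def by (intro exI[of _ ?C] allI impI main)
qed

end
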